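(* Let $p=p(n)$ satisfy $n^{-0.4} \le p < 1$. Then with probability tending to $1$ as $n\to\infty$, the random graph $G(n,p)$ satisfies $$\mathrm{PSD}[G(n,p)] \ge \frac{np}{200 \log n}.$$
   Context: $G(n,p)$ is the Erdős–Rényi random graph on $n$ labeled vertices where each pair is an edge independently with probability $p$. Let $G$ be a graph. A separating family of $G$ is a multiset $\mathcal{F}$ of total orders of $V(G)$ such that for any two disjoint edges $e,f$ of $G$ there is at least one element of $\mathcal{F}$ in which all vertices of one of the edges precede all vertices of the other. It is perfect if there is a positive integer $\lambda$ such that every pair of disjoint edges is separated in this sense by exactly $\lambda$ members of $\mathcal{F}$ (counted with multiplicity). $\mathrm{PSD}(G)$ is the smallest size of a perfect separating family of $G$. $\log=\log_2$. *)

theory Defs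
  imports "HOL-Probability.Probability" "HOL-Library.Multiset"
begin

text \<open>A finite simple graph is given by a vertex set \<open>V\<close> and a set \<open>E\<close> of two-element
  subsets of \<open>V\<close>.\<close>

definition vertex_pairs :: "'a set \<Rightarrow> 'a set set" where
  "vertex_pairs V = {e. e \<subseteq> V \<and> card e = 2}"

definition gnp_pmf :: "nat \<Rightarrow> real \<Rightarrow> nat set set pmf" where
  "gnp_pmf n p =
     map_pmf (\<lambda>X. {e \<in> vertex_pairs {..<n}. X e})
       (Pi_pmf (vertex_pairs {..<n}) False (\<lambda>_. bernoulli_pmf p))"

definition all_precede :: "('a \<times> 'a) set \<Rightarrow> 'a set \<Rightarrow> 'a set \<Rightarrow> bool" where
  "all_precede r e f \<longleftrightarrow> (\<forall>x\<in>e. \<forall>y\<in>f. (x, y) \<in> r \<and> x \<noteq> y)"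

definition separates :: "('a \<times> 'a) set \<Rightarrow> 'a set \<Rightarrow> 'a set \<Rightarrow> bool" where
  "separates r e f \<longleftrightarrow> all_precede r e f \<or> all_precede r f e"

definition separating_family ::
    "'a set \<Rightarrow> 'a set set \<Rightarrow> ('a \<times> 'a) set multiset \<Rightarrow> bool" where
  "separating_family V E F \<longleftrightarrow>
     (\<forall>r \<in># F. linear_order_on V r) \<and>
     (\<forall>e\<in>E. \<forall>f\<in>E. e \<inter> f = {} \<longrightarrow> (\<exists>r \<in># F. separates r e f))"

definition perfect_separating_family ::
    "'a set \<Rightarrow> 'a set set \<Rightarrow> ('a \<times> 'a) set multiset \<Rightarrow> bool" where
  "perfect_separating_family V E F \<longleftrightarrow>
     separating_family V E F \<and>
     (\<exists>l::nat. l > 0 \<and>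
        (\<forall>e\<in>E. \<forall>f\<in>E. e \<inter> f = {} \<longrightarrow> size (filter_mset (\<lambda>r. separates r e f) F) = l))"

text \<open>The minimum is attained for every finite simple graph: by symmetry, the family of all
  total orders of \<open>V\<close>, each taken once, is perfect.\<close>

definition PSD :: "'a set \<Rightarrow> 'a set set \<Rightarrow> nat" where
  "PSD V E = (LEAST k. \<exists>F. perfect_separating_family V E F \<and> size F = k)"

end

theory Submission
  imports Defs "HOL-Real_Asymp.Real_Asymp"
begin

text \<open>The proof is a union bound over all lists of \<open>k < n p / (200 log n)\<close> linear orders, of which there
  are at most \<open>n ^ (n k)\<close>, that is \<open>2 ^ (n\<^sup>2 p / 200)\<close>. It remains to see that a fixed list and a fixed \<open>l > 0\<close>
  are perfect for \<open>G(n, p)\<close> with probability at most \<open>exp (n / 8 - 0.0046 n\<^sup>2 p)\<close>. Call two disjoint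
  vertex pairs in conflict if they are not separated exactly \<open>l\<close> times; the edge set must then be
  an independent set of the conflict graph.

  Every order separates exactly one of the three perfect matchings of a 4-set. If \<open>3 l \<noteq> k\<close>,
  every 4-set therefore contains a conflict. If \<open>3 l = k\<close>, fix \<open>u\<close> and \<open>v\<close>, and consider those
  vertices \<open>x\<close> which are not between \<open>u\<close> and \<open>v\<close> in exactly \<open>2 l\<close> of the orders; on average these are two
  thirds of all vertices. A rank argument shows that among any \<open>2 k + 2\<close> of them there are \<open>x\<close> and \<open>y\<close>
  such that \<open>{u, x}\<close> and \<open>{v, y}\<close> are in conflict. Greedy matchings for all \<open>u\<close> and \<open>v\<close> combine to a
  conflict graph with on the order of \<open>n\<^sup>3\<close> pairs and maximum degree \<open>4 n\<close>.\<close>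

subsection \<open>Random independent sets\<close>

text \<open>The probability that a random subset of \<open>S\<close>, containing each element independently with
  probability \<open>p\<close>, spans no pair of \<open>R\<close>.\<close>

definition independent_weight :: "real \<Rightarrow> ('a \<times> 'a) set \<Rightarrow> 'a set \<Rightarrow> real" where
  "independent_weight p R S =
     (\<Sum>A\<in>{A. A \<subseteq> S \<and> R \<inter> A \<times> A = {}}. p ^ card A * (1 - p) ^ card (S - A))"

lemma sum_Pow_binomial_weight:
  fixes p :: real
  assumes "finite S"
  shows "(\<Sum>A\<in>Pow S. p ^ card A * (1 - p) ^ card (S - A)) = 1"
proof -
  have "(\<Prod>x\<in>S. p + (1 - p)) = (\<Sum>A\<in>Pow S. (\<Prod>x\<in>A. p) * (\<Prod>x\<in>S - A. 1 - p))"
    by (rule prod_add[OF assms])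
  then show ?thesis by simp
qed

lemma independent_weight_le_1:
  assumes "finite S" "0 \<le> p" "p \<le> 1"
  shows "independent_weight p R S \<le> 1"
proof -
  have "independent_weight p R S \<le> (\<Sum>A\<in>Pow S. p ^ card A * (1 - p) ^ card (S - A))"
    unfolding independent_weight_def using assms by (intro sum_mono2) auto
  then show ?thesis using sum_Pow_binomial_weight[OF assms(1)] by simp
qed

text \<open>Split the independent sets by whether they contain \<open>v\<close>. If they do, all of
  \<open>N\<close> is excluded, which accounts for the factor \<open>(1 - p) ^ card N\<close>;
  conversely avoiding \<open>N\<close> suffices because \<open>R\<close> is symmetric.\<close>

lemma independent_weight_remove_vertex:
  assumes S: "finite S" "v \<in> S" and R: "sym R" "irrefl R"
  defines "N \<equiv> R `` {v} \<inter> S"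
  shows "independent_weight p R S =
    (1 - p) * independent_weight p R (S - {v}) +
    p * (1 - p) ^ card N * independent_weight p R (S - insert v N)"
proof -
  define w where "w A = p ^ card A * (1 - p) ^ card (S - A)" for A
  define I where "I T = {A. A \<subseteq> T \<and> R \<inter> A \<times> A = {}}" for T
  have N: "N \<subseteq> S" "v \<notin> N" "finite N"
    using S R by (auto simp: N_def irrefl_def)
  have fin: "finite (I T)" if "T \<subseteq> S" for T
    using that S(1) by (auto simp: I_def intro: finite_subset[of _ "Pow S"])
  have split: "I S = I (S - {v}) \<union> insert v ` I (S - insert v N)"
  proof (intro equalityI subsetI)
    fix A assume A: "A \<in> I S"
    show "A \<in> I (S - {v}) \<union> insert v ` I (S - insert v N)"
    proof (cases "v \<in> A")
      case True
      then have "A - {v} \<in> I (S - insert v N)" "A = insert v (A - {v})"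
        using A by (auto simp: I_def N_def)
      then show ?thesis by blast
    qed (use A in \<open>auto simp: I_def\<close>)
  next
    fix A assume "A \<in> I (S - {v}) \<union> insert v ` I (S - insert v N)"
    then show "A \<in> I S"
      using S R by (auto simp: I_def N_def irrefl_def sym_def)
  qed
  have disj: "I (S - {v}) \<inter> insert v ` I (S - insert v N) = {}"
    by (auto simp: I_def)
  have inj: "inj_on (insert v) (I (S - insert v N))"
    by (rule inj_onI) (auto simp: I_def)
  have w1: "w A = (1 - p) * (p ^ card A * (1 - p) ^ card (S - {v} - A))" if "A \<in> I (S - {v})" for A
  proof -
    have "S - A = insert v (S - {v} - A)" using that S by (auto simp: I_def)
    then have "card (S - A) = Suc (card (S - {v} - A))" using S(1) by simp
    then show ?thesis by (simp add: w_def)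
  qed
  have w2: "w (insert v A) = p * (1 - p) ^ card N * (p ^ card A * (1 - p) ^ card (S - insert v N - A))"
    if "A \<in> I (S - insert v N)" for A
  proof -
    have fA: "finite A" using that S(1) by (auto simp: I_def intro: finite_subset)
    have "S - insert v A = N \<union> (S - insert v N - A)" using that N by (auto simp: I_def)
    then have "card (S - insert v A) = card N + card (S - insert v N - A)"
      using card_Un_disjoint[of N "S - insert v N - A"] N S(1) by auto
    moreover have "card (insert v A) = Suc (card A)" using that fA by (intro card_insert_disjoint) (auto simp: I_def)
    ultimately show ?thesis by (simp add: w_def power_add)
  qed
  have "independent_weight p R S = sum w (I S)"
    by (simp add: independent_weight_def w_def I_def)
  also have "\<dots> = sum w (I (S - {v})) + sum w (insert v ` I (S - insert v N))"
    unfolding split by (rule sum.union_disjoint) (use fin disj in auto)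
  also have "sum w (insert v ` I (S - insert v N)) = (\<Sum>A\<in>I (S - insert v N). w (insert v A))"
    by (simp add: sum.reindex[OF inj])
  finally show ?thesis
    by (simp add: w1 w2 sum_distrib_left independent_weight_def I_def[symmetric])
qed

text \<open>Every lost pair has a coordinate in \<open>X\<close>. Each vertex of \<open>X\<close> is
  the first coordinate of at most \<open>D\<close> pairs, and by symmetry the pairs with second
  coordinate in \<open>X\<close> are swaps of these.\<close>

lemma card_Int_square_Diff_ge:
  assumes S: "finite S" and X: "finite X" and R: "sym R"
    and deg: "\<And>x. card (R `` {x} \<inter> S) \<le> D"
  shows "card (R \<inter> S \<times> S) \<le> card (R \<inter> (S - X) \<times> (S - X)) + 2 * D * card X"
proof -
  let ?N = "\<lambda>x. R `` {x} \<inter> S"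
  let ?A = "R \<inter> (S - X) \<times> (S - X)" and ?B = "SIGMA x:X. ?N x"
  have fin: "finite ?A" "finite ?B" using S X by auto
  have "card ?B = (\<Sum>x\<in>X. card (?N x))" using S X by simp
  also have "\<dots> \<le> D * card X" using sum_bounded_above[of X "\<lambda>x. card (?N x)" D] deg by (simp add: mult.commute)
  finally have B: "card ?B \<le> D * card X" .
  have "R \<inter> S \<times> S \<subseteq> ?A \<union> ?B \<union> prod.swap ` ?B"
    using R by (force simp: sym_def image_iff)
  then have "card (R \<inter> S \<times> S) \<le> card (?A \<union> ?B \<union> prod.swap ` ?B)"
    using fin by (intro card_mono) auto
  also have "\<dots> \<le> card ?A + card ?B + card (prod.swap ` ?B)"
    by (meson card_Un_le order_trans add_mono order_refl)
  also have "card (prod.swap ` ?B) \<le> card ?B" using fin by (intro card_image_le)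
  finally show ?thesis using B by linarith
qed

text \<open>The summands are the two branches of \<open>independent_weight_remove_vertex\<close>,
  inflated by \<open>exp (p / 2)\<close> per removed vertex. Degree \<open>4 / p\<close> makes the
  second branch at most \<open>p / 4 * exp (p / 2)\<close>, and
  \<open>(1 - 3 / 4 * p) * exp (p / 2)\<close> is at most 1 by a second-order bound on
  \<open>exp\<close>.\<close>

lemma branching_factor_le_1:
  fixes p :: real
  assumes p: "0 < p" "p \<le> 1" and d: "4 / p \<le> real d"
  shows "(1 - p) * exp (p / 2) + p * (1 - p) ^ d * exp (p / 2 * (real d + 1)) \<le> 1"
proof -
  have pd: "4 \<le> p * real d" using p d by (simp add: field_simps)
  have "1 - p \<le> exp (- p)" using exp_ge_add_one_self[of "-p"] by simp
  then have "(1 - p) ^ d \<le> exp (- p) ^ d" using p by (intro power_mono) auto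
  also have "\<dots> = exp (- (p * real d))" by (simp add: exp_of_nat_mult[symmetric] mult.commute)
  finally have "(1 - p) ^ d * exp (p / 2 * (real d + 1)) \<le> exp (- (p * real d)) * exp (p / 2 * (real d + 1))"
    by (intro mult_right_mono) auto
  also have "\<dots> = exp (p / 2) * exp (- (p * real d / 2))" by (simp add: exp_add[symmetric] field_simps)
  also have "\<dots> \<le> exp (p / 2) * exp (- 2)" using pd by (intro mult_left_mono) auto
  finally have 1: "(1 - p) ^ d * exp (p / 2 * (real d + 1)) \<le> exp (p / 2) * exp (- 2)" .
  have e2: "exp (-2::real) \<le> 1/4"
  proof -
    have "(4::real) \<le> exp 1 ^ 2" using power_mono[of 2 "exp (1::real)" 2] exp_ge_add_one_self[of "1::real"] by simp
    also have "\<dots> = exp 2" by (simp add: exp_of_nat_mult[symmetric])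
    finally show ?thesis by (simp add: exp_minus field_simps)
  qed
  have half: "exp (p / 2) \<le> 1 + p / 2 + (p / 2)\<^sup>2" using p by (intro exp_bound) auto
  have "(1 - p) * exp (p / 2) + p * (1 - p) ^ d * exp (p / 2 * (real d + 1))
      = (1 - p) * exp (p / 2) + p * ((1 - p) ^ d * exp (p / 2 * (real d + 1)))" by simp
  also have "\<dots> \<le> (1 - p) * exp (p / 2) + p * (exp (p / 2) * (1 / 4))"
    using p 1 e2 by (intro add_left_mono mult_left_mono order_trans[OF 1]) auto
  also have "\<dots> = (1 - 3 / 4 * p) * exp (p / 2)" by (simp add: algebra_simps)
  also have "\<dots> \<le> (1 - 3 / 4 * p) * (1 + p / 2 + (p / 2)\<^sup>2)"
    using p half by (intro mult_left_mono) auto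
  also have "\<dots> = 1 - p / 4 * (1 + p / 2 + 3 / 4 * p\<^sup>2)"
    by (simp add: power2_eq_square field_simps)
  also have "\<dots> \<le> 1" using p by simp
  finally show ?thesis .
qed

text \<open>Averaging: the degrees inside \<open>S\<close> sum to the number of pairs.\<close>

lemma exists_large_degree:
  fixes c :: real
  assumes "finite S" "c * card S < card (R \<inter> S \<times> S)"
  shows "\<exists>v\<in>S. c \<le> card (R `` {v} \<inter> S)"
proof (rule ccontr)
  assume "\<not> ?thesis"
  then have *: "card (R `` {v} \<inter> S) \<le> c" if "v \<in> S" for v using that by force
  have "R \<inter> S \<times> S = (SIGMA v:S. R `` {v} \<inter> S)" by auto
  then have "real (card (R \<inter> S \<times> S)) = (\<Sum>v\<in>S. real (card (R `` {v} \<inter> S)))"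
    using assms(1) by simp
  also have "\<dots> \<le> c * card S"
    using sum_bounded_above[of S "\<lambda>v. real (card (R `` {v} \<inter> S))" c] * by (simp add: mult.commute)
  finally show False using assms(2) by simp
qed

text \<open>As long as \<open>R\<close> has more than \<open>(4 / p) * card S\<close> pairs, some vertex \<open>v\<close> has degree at least
  \<open>4 / p\<close>. Removing \<open>v\<close> (if it is not chosen) or \<open>v\<close> with all its neighbours (if it is chosen)
  costs at most \<open>2 * D\<close> pairs per removed vertex, so the bound survives the recursion.\<close>

lemma independent_weight_le:
  assumes "finite S" and p: "0 < p" "p \<le> 1" and R: "sym R" "irrefl R"
    and D: "D > 0" and deg: "\<And>x. card (R `` {x} \<inter> S) \<le> D"
  shows "independent_weight p R S
    \<le> exp (- (p / (4 * real D)) * (real (card (R \<inter> S \<times> S)) - 4 / p * real (card S)))"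
  using assms(1) deg
proof (induction "card S" arbitrary: S rule: less_induct)
  case less
  note fin = \<open>finite S\<close>
  \<comment> \<open>With this rate, losing \<open>2 * D\<close> pairs costs a factor
    \<open>exp (p / 2)\<close>, which is what \<open>branching_factor_le_1\<close> can absorb per
    removed vertex.\<close>
  define b where "b = p / (4 * real D)"
  define g where "g T = real (card (R \<inter> T \<times> T)) - 4 / p * real (card T)" for T
  have b: "b > 0" "b * (2 * real D) = p / 2" using p D by (auto simp: b_def field_simps)
  show ?case
  proof (cases "real (card (R \<inter> S \<times> S)) \<le> 4 / p * real (card S)")
    case True
    \<comment> \<open>With so few pairs the claimed bound is at least 1.\<close>
    then have "0 \<le> - b * g S" using b by (simp add: g_def mult_le_0_iff)
    then have "1 \<le> exp (- b * g S)" by simp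
    then show ?thesis using independent_weight_le_1[OF fin, of p R] p
      unfolding b_def g_def by linarith
  next
    case False
    then obtain v where v: "v \<in> S" "4 / p \<le> card (R `` {v} \<inter> S)"
      using exists_large_degree[OF fin, of "4 / p" R] by auto
    define N where "N = R `` {v} \<inter> S"
    have N: "finite N" "v \<notin> N" "N \<subseteq> S" using fin R by (auto simp: N_def irrefl_def)
    have IH: "independent_weight p R (S - X) \<le> exp (- b * g S) * exp (p / 2 * real (card X))"
      if X: "X \<subseteq> S" "v \<in> X" for X
    proof -
      have fX: "finite X" using X fin finite_subset by blast
      have "card (S - X) < card S" using X v fin by (intro psubset_card_mono) auto
      moreover have "card (R `` {x} \<inter> (S - X)) \<le> D" for x
        by (rule order_trans[OF card_mono less.prems(2)[of x]]) (use fin in auto)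
      ultimately have *: "independent_weight p R (S - X) \<le> exp (- b * g (S - X))"
        using less.hyps[of "S - X"] fin unfolding b_def g_def by auto
      have "card (R \<inter> S \<times> S) \<le> card (R \<inter> (S - X) \<times> (S - X)) + 2 * D * card X"
        by (rule card_Int_square_Diff_ge) (use fin fX R less.prems in auto)
      then have "real (card (R \<inter> S \<times> S)) \<le> real (card (R \<inter> (S - X) \<times> (S - X)) + 2 * D * card X)"
        by (simp only: of_nat_le_iff)
      moreover have "4 / p * real (card (S - X)) \<le> 4 / p * real (card S)"
        using p fin by (intro mult_left_mono) (auto intro: card_mono)
      ultimately have "g S \<le> g (S - X) + 2 * real D * real (card X)" by (simp add: g_def)
      then have "b * g S \<le> b * (g (S - X) + 2 * real D * real (card X))"
        using b by (intro mult_left_mono) auto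
      also have "\<dots> = b * g (S - X) + p / 2 * real (card X)"
        using b(2) by (simp add: algebra_simps)
      finally have "exp (- b * g (S - X)) \<le> exp (- b * g S + p / 2 * real (card X))" by simp
      then show ?thesis using * by (simp only: exp_add)
    qed
    have "independent_weight p R S = (1 - p) * independent_weight p R (S - {v})
        + p * (1 - p) ^ card N * independent_weight p R (S - insert v N)"
      unfolding N_def by (rule independent_weight_remove_vertex) (use fin v R in auto)
    also have "\<dots> \<le> (1 - p) * (exp (- b * g S) * exp (p / 2))
        + p * (1 - p) ^ card N * (exp (- b * g S) * exp (p / 2 * (real (card N) + 1)))"
      using IH[of "{v}"] IH[of "insert v N"] N v p
      by (intro add_mono mult_left_mono) (auto simp: add.commute)
    also have "\<dots> = exp (- b * g S) * ((1 - p) * exp (p / 2)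
        + p * (1 - p) ^ card N * exp (p / 2 * (real (card N) + 1)))"
      by (simp add: algebra_simps)
    also have "\<dots> \<le> exp (- b * g S) * 1"
      by (intro mult_left_mono branching_factor_le_1) (use p v in \<open>auto simp: N_def\<close>)
    finally show ?thesis unfolding b_def g_def by simp
  qed
qed

subsection \<open>Linear algebra and matchings\<close>

text \<open>Gaussian elimination for a homogeneous system with more unknowns than equations, by
  induction on the equations.\<close>

lemma exists_nontrivial_kernel_vector:
  fixes g :: "'i \<Rightarrow> 'a \<Rightarrow> real"
  assumes "finite I" "finite W" "card I < card W"
  shows "\<exists>c. (\<exists>x\<in>W. c x \<noteq> 0) \<and> (\<forall>i\<in>I. (\<Sum>x\<in>W. c x * g i x) = 0)"
  using assms
proof (induction I arbitrary: W g rule: finite_induct)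
  case empty
  then have "W \<noteq> {}" by auto
  then show ?case by (intro exI[of _ "\<lambda>_. 1"]) auto
next
  case (insert j I)
  show ?case
  proof (cases "\<forall>x\<in>W. g j x = 0")
    case True
    then have "(\<Sum>x\<in>W. c x * g j x) = 0" for c by simp
    then show ?thesis using insert.IH[of W g] insert.prems insert.hyps by auto
  next
    case False
    then obtain w where w: "w \<in> W" "g j w \<noteq> 0" by blast
    \<comment> \<open>Row \<open>i\<close> with the unknown \<open>w\<close> eliminated by means of
      row \<open>j\<close>; the value \<open>t\<close> below then solves row \<open>j\<close> for
      \<open>w\<close>.\<close>
    define h where "h i x = g i x - g j x / g j w * g i w" for i x
    have "card I < card (W - {w})" using insert.prems insert.hyps w by (simp add: card_Diff_singleton)
    then obtain c where c: "\<exists>x\<in>W - {w}. c x \<noteq> 0" "\<forall>i\<in>I. (\<Sum>x\<in>W - {w}. c x * h i x) = 0"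
      using insert.IH[of "W - {w}" h] insert.prems by auto
    define t where "t = - (\<Sum>x\<in>W - {w}. c x * g j x) / g j w"
    have expand: "(\<Sum>x\<in>W. (c(w := t)) x * g i x) = (\<Sum>x\<in>W - {w}. c x * h i x)" for i
    proof -
      have "(\<Sum>x\<in>W. (c(w := t)) x * g i x) = t * g i w + (\<Sum>x\<in>W - {w}. c x * g i x)"
        using insert.prems w by (subst sum.remove[of W w]) (auto intro!: sum.cong)
      also have "\<dots> = (\<Sum>x\<in>W - {w}. c x * g i x - c x * g j x * (g i w / g j w))"
        by (simp add: t_def sum_subtractf sum_distrib_right sum_divide_distrib)
      also have "\<dots> = (\<Sum>x\<in>W - {w}. c x * h i x)"
        by (simp add: h_def algebra_simps)
      finally show ?thesis .
    qed
    have "h j x = 0" for x using w by (simp add: h_def)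
    then show ?thesis using c expand by (intro exI[of _ "c(w := t)"]) auto
  qed
qed

text \<open>A diagonal matrix with nonzero entries has full rank \<open>card W\<close>, while a sum
  of \<open>card I\<close> rank-one matrices has rank at most \<open>card I\<close>. Concretely, a
  vector \<open>c\<close> killed by all \<open>f i\<close> would satisfy
  \<open>c y * d y = 0\<close> for every \<open>y\<close>.\<close>

lemma card_le_if_diagonal_eq_sum_rank_one:
  fixes f g :: "'i \<Rightarrow> 'a \<Rightarrow> real" and d :: "'a \<Rightarrow> real"
  assumes I: "finite I" and W: "finite W" and d: "\<And>x. x \<in> W \<Longrightarrow> d x \<noteq> 0"
    and eq: "\<And>x y. x \<in> W \<Longrightarrow> y \<in> W \<Longrightarrow> (\<Sum>i\<in>I. f i x * g i y) = (if x = y then d x else 0)"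
  shows "card W \<le> card I"
proof (rule ccontr)
  assume "\<not> card W \<le> card I"
  then obtain c where c: "\<exists>x\<in>W. c x \<noteq> 0" "\<forall>i\<in>I. (\<Sum>x\<in>W. c x * f i x) = 0"
    using exists_nontrivial_kernel_vector[OF I W] by (metis linorder_not_le)
  have "c y = 0" if y: "y \<in> W" for y
  proof -
    have "c y * d y = (\<Sum>x\<in>W. c x * (if x = y then d x else 0))"
      using W y by (simp add: sum.delta if_distrib cong: if_cong)
    also have "\<dots> = (\<Sum>x\<in>W. \<Sum>i\<in>I. c x * f i x * g i y)"
      using y by (intro sum.cong) (auto simp flip: eq simp: sum_distrib_left mult.assoc)
    also have "\<dots> = (\<Sum>i\<in>I. (\<Sum>x\<in>W. c x * f i x) * g i y)"
      by (subst sum.swap) (simp add: sum_distrib_right)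
    also have "\<dots> = 0" using c by simp
    finally show ?thesis using d[OF y] by simp
  qed
  then show False using c by blast
qed

text \<open>Greedy choice: while more than \<open>N\<close> elements remain, take a pair and delete
  both its elements. The pairs are ordered since \<open>B\<close> need not be symmetric; injectivity
  of both projections is what later bounds degrees.\<close>

lemma exists_large_partial_matching:
  assumes "finite X"
    and "\<And>W. W \<subseteq> X \<Longrightarrow> N < card W \<Longrightarrow> \<exists>x\<in>W. \<exists>y\<in>W. x \<noteq> y \<and> B x y"
  shows "\<exists>P \<subseteq> X \<times> X. (\<forall>(x, y)\<in>P. x \<noteq> y \<and> B x y) \<and> inj_on fst P \<and> inj_on snd P \<and>
           card X \<le> 2 * card P + N"
  using assms
proof (induction "card X" arbitrary: X rule: less_induct)
  case less
  show ?case
  proof (cases "card X \<le> N")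
    case True
    then show ?thesis by (intro exI[of _ "{}"]) auto
  next
    case False
    then obtain x y where xy: "x \<in> X" "y \<in> X" "x \<noteq> y" "B x y"
      using less.prems(2)[of X] by auto
    define Y where "Y = X - {x, y}"
    have Y: "card X = card Y + 2"
    proof -
      have "card X = card (insert x (insert y Y))" using xy by (intro arg_cong[of _ _ card]) (auto simp: Y_def)
      then show ?thesis using xy less.prems(1) by (simp add: Y_def)
    qed
    then obtain P where P: "P \<subseteq> Y \<times> Y" "\<forall>(x, y)\<in>P. x \<noteq> y \<and> B x y" "inj_on fst P" "inj_on snd P"
        "card Y \<le> 2 * card P + N"
    proof -
      have "\<exists>x\<in>W. \<exists>y\<in>W. x \<noteq> y \<and> B x y" if "W \<subseteq> Y" "N < card W" for W
        by (rule less.prems(2)[OF _ that(2)]) (use that(1) in \<open>auto simp: Y_def\<close>)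
      then show ?thesis using less.hyps[of Y] less.prems(1) Y that by (force simp: Y_def)
    qed
    have sub: "insert (x, y) P \<subseteq> X \<times> X" using P(1) xy unfolding Y_def by blast
    have "finite P" using P(1) less.prems(1) by (auto simp: Y_def intro: finite_subset)
    moreover have "(x, y) \<notin> P" using P(1) by (auto simp: Y_def)
    ultimately have "card (insert (x, y) P) = Suc (card P)" by simp
    moreover have "inj_on fst (insert (x, y) P)" "inj_on snd (insert (x, y) P)"
      using P(1,3,4) unfolding Y_def by auto
    ultimately show ?thesis
      using P(2,5) Y xy by (intro exI[of _ "insert (x, y) P"] conjI sub) auto
  qed
qed

subsection \<open>Ranks in linear orders\<close>

text \<open>Ranks turn comparisons in an order into comparisons of natural numbers.\<close>

definition rank_in :: "('a \<times> 'a) set \<Rightarrow> 'a \<Rightarrow> nat" where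
  "rank_in r x = card {y. (y, x) \<in> r \<and> y \<noteq> x}"

lemma rank_in_less_iff:
  assumes V: "finite V" and r: "linear_order_on V r" and xy: "x \<in> V" "y \<in> V"
  shows "rank_in r x < rank_in r y \<longleftrightarrow> (x, y) \<in> r \<and> x \<noteq> y"
proof -
  have rV: "r \<subseteq> V \<times> V" and tr: "trans r" and as: "antisym r" and tot: "total_on V r"
    using r by (auto simp: order_on_defs)
  have *: "rank_in r a < rank_in r b" if "(a, b) \<in> r" "a \<noteq> b" for a b
    unfolding rank_in_def
  proof (rule psubset_card_mono)
    show "finite {y. (y, b) \<in> r \<and> y \<noteq> b}"
      by (rule finite_subset[OF _ V]) (use rV in auto)
    show "{y. (y, a) \<in> r \<and> y \<noteq> a} \<subset> {y. (y, b) \<in> r \<and> y \<noteq> b}"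
      using that tr as unfolding trans_def antisym_def by blast
  qed
  show ?thesis
    using * tot xy by (metis less_asym less_irrefl total_on_def)
qed

lemma rank_in_less_card:
  assumes V: "finite V" and r: "linear_order_on V r" and x: "x \<in> V"
  shows "rank_in r x < card V"
  unfolding rank_in_def
  by (rule psubset_card_mono[OF V]) (use r x in \<open>auto simp: order_on_defs\<close>)

lemma inj_on_rank_in:
  assumes V: "finite V" and r: "linear_order_on V r"
  shows "inj_on (rank_in r) V"
  using rank_in_less_iff[OF assms] r
  by (auto intro!: inj_onI simp: order_on_defs total_on_def) (metis less_irrefl)

lemma all_precede_pair_iff:
  assumes V: "finite V" and r: "linear_order_on V r" and "a \<in> V" "b \<in> V" "c \<in> V" "d \<in> V"
  shows "all_precede r {a, b} {c, d} \<longleftrightarrow>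
    rank_in r a < rank_in r c \<and> rank_in r a < rank_in r d \<and>
    rank_in r b < rank_in r c \<and> rank_in r b < rank_in r d"
  using assms by (auto simp: all_precede_def rank_in_less_iff)

text \<open>An order is determined by its rank function from \<open>V\<close> to
  \<open>{..<card V}\<close>. This is cruder than the factorial but precise enough for the union
  bound.\<close>

lemma card_linear_orders_le:
  fixes V :: "'a set"
  assumes V: "finite V"
  shows "finite {r. linear_order_on V r}"
    and "card {r. linear_order_on V r} \<le> card V ^ card V"
proof -
  let ?L = "{r. linear_order_on V r}"
  let ?h = "\<lambda>r. restrict (rank_in r) V"
  have sub: "r \<subseteq> V \<times> V" if "r \<in> ?L" for r using that by (auto simp: order_on_defs)
  show fin: "finite ?L"
    by (rule finite_subset[of _ "Pow (V \<times> V)"]) (use sub V in auto)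
  have inj: "inj_on ?h ?L"
  proof (rule inj_onI)
    fix r s assume r: "r \<in> ?L" and s: "s \<in> ?L" and eq: "?h r = ?h s"
    have rank: "rank_in r x = rank_in s x" if "x \<in> V" for x
      using fun_cong[OF eq, of x] that by simp
    have "(x, y) \<in> r \<longleftrightarrow> (x, y) \<in> s" for x y
    proof (cases "x \<in> V \<and> y \<in> V")
      case True
      then show ?thesis
        using rank_in_less_iff[OF V, of r x y] rank_in_less_iff[OF V, of s x y] rank r s
        by (cases "x = y") (auto simp: order_on_defs refl_on_def)
    qed (use sub r s in blast)
    then show "r = s" by auto
  qed
  have "card ?L = card (?h ` ?L)" by (simp add: card_image inj)
  also have "\<dots> \<le> card (V \<rightarrow>\<^sub>E {..<card V})"
    by (rule card_mono) (use V rank_in_less_card in \<open>auto intro!: finite_PiE\<close>)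
  also have "\<dots> = card V ^ card V" using V by (simp add: card_PiE)
  finally show "card ?L \<le> card V ^ card V" .
qed

text \<open>Here \<open>ab\<close> stands for the comparison \<open>a < b\<close>, and so on; the assumptions express transitivity.\<close>

lemma order_pattern_identities:
  assumes "ab \<Longrightarrow> bc \<Longrightarrow> ac" "\<not> ab \<Longrightarrow> \<not> bc \<Longrightarrow> \<not> ac"
    "ab \<Longrightarrow> bd \<Longrightarrow> ad" "\<not> ab \<Longrightarrow> \<not> bd \<Longrightarrow> \<not> ad"
    "ac \<Longrightarrow> cd \<Longrightarrow> ad" "\<not> ac \<Longrightarrow> \<not> cd \<Longrightarrow> \<not> ad"
    "bc \<Longrightarrow> cd \<Longrightarrow> bd" "\<not> bc \<Longrightarrow> \<not> cd \<Longrightarrow> \<not> bd"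
  shows "of_bool (ac \<and> ad \<and> bc \<and> bd \<or> \<not> ac \<and> \<not> bc \<and> \<not> ad \<and> \<not> bd) +
      of_bool (ab \<and> ad \<and> \<not> bc \<and> cd \<or> \<not> ab \<and> bc \<and> \<not> ad \<and> \<not> cd) +
      of_bool (ab \<and> ac \<and> \<not> bd \<and> \<not> cd \<or> \<not> ab \<and> bd \<and> \<not> ac \<and> cd) = (1 :: nat)"
    and "of_bool (ab \<and> ad \<and> \<not> bc \<and> cd \<or> \<not> ab \<and> bc \<and> \<not> ad \<and> \<not> cd) +
      of_bool (ab \<and> ac \<and> \<not> bd \<and> \<not> cd \<or> \<not> ab \<and> bd \<and> \<not> ac \<and> cd) =
      (1 :: real) - of_bool (\<not> ac \<and> \<not> bc) * of_bool (\<not> ad \<and> \<not> bd)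
        - of_bool (ac \<and> bc) * of_bool (ad \<and> bd)"
  using assms by (cases ab; cases ac; cases ad; cases bc; cases bd; cases cd; simp)+

text \<open>Of the three ways to split four numbers into pairs, only the two smallest against the
  two largest is separated. Hence one of the two crossing splits is separated unless
  \<open>c\<close> and \<open>d\<close> lie both below or both above \<open>a\<close> and
  \<open>b\<close>.\<close>

lemma pair_separation_identities:
  fixes a b c d :: nat
  assumes "distinct [a, b, c, d]"
  defines "s \<equiv> \<lambda>a b c d. a < c \<and> a < d \<and> b < c \<and> b < d \<or> c < a \<and> c < b \<and> d < a \<and> d < b"
  shows "of_bool (s a b c d) + of_bool (s a c b d) + of_bool (s a d b c) = (1 :: nat)"
    and "of_bool (s a c b d) + of_bool (s a d b c) =
      (1 :: real) - of_bool (c < a \<and> c < b) * of_bool (d < a \<and> d < b)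
        - of_bool (a < c \<and> b < c) * of_bool (a < d \<and> b < d)"
proof -
  \<comment> \<open>Distinctness turns reversed comparisons into negations, which leaves six Boolean
    atoms.\<close>
  have neg: "b < a \<longleftrightarrow> \<not> a < b" "c < a \<longleftrightarrow> \<not> a < c" "d < a \<longleftrightarrow> \<not> a < d"
      "c < b \<longleftrightarrow> \<not> b < c" "d < b \<longleftrightarrow> \<not> b < d" "d < c \<longleftrightarrow> \<not> c < d"
    using assms(1) by auto
  note * = order_pattern_identities[of "a < b" "b < c" "a < c" "b < d" "a < d" "c < d"]
  show "of_bool (s a b c d) + of_bool (s a c b d) + of_bool (s a d b c) = (1 :: nat)"
    unfolding s_def neg by (rule *(1)) (use assms(1) in auto)
  show "of_bool (s a c b d) + of_bool (s a d b c) =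
      (1 :: real) - of_bool (c < a \<and> c < b) * of_bool (d < a \<and> d < b)
        - of_bool (a < c \<and> b < c) * of_bool (a < d \<and> b < d)"
    unfolding s_def neg by (rule *(2)) (use assms(1) in auto)
qed

lemma separates_three_matchings:
  assumes V: "finite V" and r: "linear_order_on V r"
    and "a \<in> V" "b \<in> V" "c \<in> V" "d \<in> V" and dist: "distinct [a, b, c, d]"
  shows "of_bool (separates r {a, b} {c, d}) + of_bool (separates r {a, c} {b, d})
    + of_bool (separates r {a, d} {b, c}) = (1 :: nat)"
proof -
  note iff = all_precede_pair_iff[OF V r]
  have "rank_in r x \<noteq> rank_in r y" if "x \<in> V" "y \<in> V" "x \<noteq> y" for x y
    using inj_on_rank_in[OF V r] that by (auto dest: inj_onD)
  then have "distinct [rank_in r a, rank_in r b, rank_in r c, rank_in r d]"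
    using assms by auto
  from pair_separation_identities(1)[OF this] show ?thesis
    unfolding separates_def using assms by (simp only: iff)
qed

definition below_both :: "('a \<times> 'a) set \<Rightarrow> 'a \<Rightarrow> 'a \<Rightarrow> 'a \<Rightarrow> bool" where
  "below_both r u v x \<longleftrightarrow> rank_in r x < rank_in r u \<and> rank_in r x < rank_in r v"

definition above_both :: "('a \<times> 'a) set \<Rightarrow> 'a \<Rightarrow> 'a \<Rightarrow> 'a \<Rightarrow> bool" where
  "above_both r u v x \<longleftrightarrow> rank_in r u < rank_in r x \<and> rank_in r v < rank_in r x"

definition between :: "('a \<times> 'a) set \<Rightarrow> 'a \<Rightarrow> 'a \<Rightarrow> 'a \<Rightarrow> bool" where
  "between r u v x \<longleftrightarrow> \<not> below_both r u v x \<and> \<not> above_both r u v x"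

text \<open>Three distinct ranks have exactly one median.\<close>

lemma between_rotations:
  assumes V: "finite V" and r: "linear_order_on V r"
    and "u \<in> V" "v \<in> V" "x \<in> V" and dist: "distinct [u, v, x]"
  shows "of_bool (between r u v x) + of_bool (between r v x u) + of_bool (between r x u v) = (1 :: nat)"
proof -
  have "rank_in r x \<noteq> rank_in r y" if "x \<in> V" "y \<in> V" "x \<noteq> y" for x y
    using inj_on_rank_in[OF V r] that by (auto dest: inj_onD)
  then have "rank_in r u \<noteq> rank_in r v" "rank_in r u \<noteq> rank_in r x" "rank_in r v \<noteq> rank_in r x"
    using assms by auto
  then show ?thesis
    unfolding between_def below_both_def above_both_def
    by (cases "rank_in r u < rank_in r v"; cases "rank_in r u < rank_in r x";
        cases "rank_in r v < rank_in r x"; simp)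
qed

text \<open>The products on the right each separate \<open>x\<close> from \<open>y\<close>, so as
  matrices in \<open>x\<close> and \<open>y\<close> they have rank at most one; this is the form
  needed for the rank argument.\<close>

lemma separates_crossing_pairs:
  assumes V: "finite V" and r: "linear_order_on V r"
    and "u \<in> V" "v \<in> V" "x \<in> V" "y \<in> V" and dist: "distinct [u, v, x, y]"
  shows "of_bool (separates r {u, x} {v, y}) + of_bool (separates r {u, y} {v, x}) =
    (1 :: real) - of_bool (below_both r u v x) * of_bool (below_both r u v y)
      - of_bool (above_both r u v x) * of_bool (above_both r u v y)"
proof -
  note iff = all_precede_pair_iff[OF V r]
  have "rank_in r x \<noteq> rank_in r y" if "x \<in> V" "y \<in> V" "x \<noteq> y" for x y
    using inj_on_rank_in[OF V r] that by (auto dest: inj_onD)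
  then have "distinct [rank_in r u, rank_in r v, rank_in r x, rank_in r y]"
    using assms by auto
  from pair_separation_identities(2)[OF this] show ?thesis
    unfolding separates_def below_both_def above_both_def using assms
    by (simp only: iff)
qed

section \<open>Counting vertex tuples and vertex pairs\<close>

lemma card_ordered_pairs_of_doubleton: "card {(a, b). {a, b} = e} \<le> 2" "finite {(a, b). {a, b} = e}"
proof -
  have "\<exists>q q'. {(a, b). {a, b} = e} \<subseteq> {q, q'}"
  proof (cases "\<exists>a b. {a, b} = e")
    case True
    then obtain a b where e: "e = {a, b}" by blast
    have "{(a, b). {a, b} = e} \<subseteq> {(a, b), (b, a)}" unfolding e doubleton_eq_iff by blast
    then show ?thesis by blast
  qed auto
  then obtain q q' where q: "{(a, b). {a, b} = e} \<subseteq> {q, q'}" by blast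
  then show "finite {(a, b). {a, b} = e}" by (rule finite_subset) simp
  have "card {(a, b). {a, b} = e} \<le> card {q, q'}" using q by (intro card_mono) auto
  also have "\<dots> \<le> 2" by (simp add: card_insert_if)
  finally show "card {(a, b). {a, b} = e} \<le> 2" .
qed

text \<open>Each of the two sets comes from at most two ordered pairs. This converts counts of
  vertex quadruples into counts of conflicts.\<close>

lemma card_le_card_doubleton_pairs:
  assumes "finite Q"
  shows "card Q \<le> 4 * card ((\<lambda>((a, b), (c, d)). ({a, b}, {c, d})) ` Q)"
proof -
  let ?h = "\<lambda>((a, b), (c, d)). ({a, b}, {c, d})"
  let ?F = "\<lambda>e. {(a, b). {a, b} = e}"
  have "Q \<subseteq> (\<Union>(e, f)\<in>?h ` Q. ?F e \<times> ?F f)" by force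
  then have "card Q \<le> card (\<Union>(e, f)\<in>?h ` Q. ?F e \<times> ?F f)"
    using assms by (intro card_mono finite_UN_I) (auto intro!: finite_cartesian_product card_ordered_pairs_of_doubleton(2))
  also have "\<dots> \<le> (\<Sum>(e, f)\<in>?h ` Q. card (?F e \<times> ?F f))"
    using assms card_UN_le[of "?h ` Q" "\<lambda>(e, f). ?F e \<times> ?F f"] by (simp add: case_prod_unfold)
  also have "\<dots> \<le> (\<Sum>(e, f)\<in>?h ` Q. 2 * 2)"
    unfolding card_cartesian_product case_prod_unfold
    by (rule sum_mono, rule mult_le_mono) (rule card_ordered_pairs_of_doubleton(1)[unfolded case_prod_unfold])+
  finally show ?thesis by (simp add: case_prod_unfold mult.commute)
qed

lemma card_distinct_triples:
  assumes "finite V"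
  defines "n \<equiv> card V"
  shows "card (SIGMA u:V. SIGMA v:V - {u}. V - {u, v}) = n * (n - 1) * (n - 2)"
proof -
  have c: "card (V - {u, v}) = n - 2" if "u \<in> V" "v \<in> V - {u}" for u v
    using that assms by (subst card_Diff_subset) (auto simp: card_insert_if)
  have "card (SIGMA u:V. SIGMA v:V - {u}. V - {u, v}) = (\<Sum>u\<in>V. \<Sum>v\<in>V - {u}. card (V - {u, v}))"
    using assms by simp
  also have "\<dots> = (\<Sum>u\<in>V. \<Sum>v\<in>V - {u}. n - 2)" using c by (intro sum.cong refl) auto
  finally show ?thesis using assms by simp
qed

lemma card_distinct_quadruples:
  assumes "finite V"
  defines "n \<equiv> card V"
  shows "card (SIGMA a:V. SIGMA b:V - {a}. SIGMA c:V - {a, b}. V - {a, b, c}) = n * (n - 1) * (n - 2) * (n - 3)"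
proof -
  have c: "card (V - {a, b, c}) = n - 3" if "a \<in> V" "b \<in> V - {a}" "c \<in> V - {a, b}" for a b c
    using that assms by (subst card_Diff_subset) (auto simp: card_insert_if)
  have c2: "card (V - {a, b}) = n - 2" if "a \<in> V" "b \<in> V - {a}" for a b
    using that assms by (subst card_Diff_subset) (auto simp: card_insert_if)
  have "card (SIGMA a:V. SIGMA b:V - {a}. SIGMA c:V - {a, b}. V - {a, b, c}) =
      (\<Sum>a\<in>V. \<Sum>b\<in>V - {a}. \<Sum>c\<in>V - {a, b}. card (V - {a, b, c}))"
    using assms by simp
  also have "\<dots> = (\<Sum>a\<in>V. \<Sum>b\<in>V - {a}. \<Sum>c\<in>V - {a, b}. n - 3)"
    using c by (intro sum.cong refl) auto
  also have "\<dots> = (\<Sum>a\<in>V. \<Sum>b\<in>V - {a}. (n - 2) * (n - 3))"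
    using c2 by (intro sum.cong refl) (auto simp: n_def)
  finally show ?thesis using assms by (simp add: mult.assoc)
qed

lemma finite_vertex_pairs: "finite V \<Longrightarrow> finite (vertex_pairs V)"
  by (auto simp: vertex_pairs_def)

lemma card_vertex_pairs_le: "finite V \<Longrightarrow> 2 * card (vertex_pairs V) \<le> card V ^ 2"
  by (simp add: vertex_pairs_def n_subsets choose_two power2_eq_square)
     (metis diff_le_self mult_le_mono2 div_times_less_eq_dividend order_trans mult.commute)

lemma doubleton_in_vertex_pairs_iff:
  "{a, b} \<in> vertex_pairs V \<longleftrightarrow> a \<in> V \<and> b \<in> V \<and> a \<noteq> b"
  by (auto simp: vertex_pairs_def card_insert_if)

subsection \<open>Conflicts of a family of orders\<close>

text \<open>Indexing by \<open>i < k\<close> keeps multiplicities: the same order may occur several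
  times. Nothing is assumed of \<open>r\<close> from index \<open>k\<close> on, so
  \<open>nth xs\<close> fits.\<close>

locale order_family =
  fixes V :: "'a set" and k :: nat and r :: "nat \<Rightarrow> ('a \<times> 'a) set"
  assumes finite_V: "finite V" and linear_order: "\<And>i. i < k \<Longrightarrow> linear_order_on V (r i)"
begin

definition sep_count :: "'a set \<Rightarrow> 'a set \<Rightarrow> nat" where
  "sep_count e f = (\<Sum>i<k. of_bool (separates (r i) e f))"

definition between_count :: "'a \<Rightarrow> 'a \<Rightarrow> 'a \<Rightarrow> nat" where
  "between_count u v x = (\<Sum>i<k. of_bool (between (r i) u v x))"

definition conflicts :: "nat \<Rightarrow> ('a set \<times> 'a set) set" where
  "conflicts l = {(e, f). e \<in> vertex_pairs V \<and> f \<in> vertex_pairs V \<and> e \<inter> f = {} \<and> sep_count e f \<noteq> l}"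

lemma sep_count_commute: "sep_count e f = sep_count f e"
  by (simp add: sep_count_def separates_def disj_commute)

lemma sym_conflicts: "sym (conflicts l)"
  by (auto simp: sym_def conflicts_def sep_count_commute)

lemma irrefl_conflicts: "irrefl (conflicts l)"
  by (auto simp: irrefl_def conflicts_def vertex_pairs_def)

lemma conflicts_subset: "conflicts l \<subseteq> vertex_pairs V \<times> vertex_pairs V"
  by (auto simp: conflicts_def)

lemma sep_count_three_matchings:
  assumes "a \<in> V" "b \<in> V" "c \<in> V" "d \<in> V" "distinct [a, b, c, d]"
  shows "sep_count {a, b} {c, d} + sep_count {a, c} {b, d} + sep_count {a, d} {b, c} = k"
  unfolding sep_count_def sum.distrib[symmetric]
  using separates_three_matchings[OF finite_V linear_order assms] by simp

lemma between_count_rotations: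
  assumes "u \<in> V" "v \<in> V" "x \<in> V" "distinct [u, v, x]"
  shows "between_count u v x + between_count v x u + between_count x u v = k"
  unfolding between_count_def sum.distrib[symmetric]
  using between_rotations[OF finite_V linear_order assms] by simp

text \<open>If no pair from \<open>W\<close> is in conflict, the diagonal matrix with entries
  \<open>between_count u v x - 2 * l\<close> is a multiple of the all-ones matrix minus the rank-one matrices
  of the sets of vertices below, respectively above, both \<open>u\<close> and \<open>v\<close> in each order.\<close>

lemma card_conflict_free_le:
  assumes uv: "u \<in> V" "v \<in> V" "u \<noteq> v" and W: "W \<subseteq> V - {u, v}"
    and diag: "\<And>x. x \<in> W \<Longrightarrow> between_count u v x \<noteq> 2 * l"
    and free: "\<And>x y. x \<in> W \<Longrightarrow> y \<in> W \<Longrightarrow> x \<noteq> y \<Longrightarrow> sep_count {u, x} {v, y} = l"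
  shows "card W \<le> 2 * k + 1"
proof -
  \<comment> \<open>\<open>None\<close> indexes the multiple of the all-ones matrix,
    \<open>Some (i, s)\<close> the two rank-one matrices of order \<open>i\<close>; hence the bound
    \<open>2 * k + 1\<close>.\<close>
  define J where "J = insert None (Some ` ({..<k} \<times> (UNIV :: bool set)))"
  define b where "b = (\<lambda>i x. of_bool (below_both (r i) u v x) :: real)"
  define a where "a = (\<lambda>i x. of_bool (above_both (r i) u v x) :: real)"
  define t where "t = (\<lambda>(i, s) x. if s then b i x else a i x)"
  define f where "f = (\<lambda>j x. case j of None \<Rightarrow> real k - 2 * real l | Some q \<Rightarrow> - t q x)"
  define g where "g = (\<lambda>j x. case j of None \<Rightarrow> 1 | Some q \<Rightarrow> t q x)"
  have J: "finite J" "card J = 2 * k + 1"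
    by (auto simp: J_def card_insert_if card_image card_cartesian_product card_UNIV_bool)
  have expand: "(\<Sum>j\<in>J. f j x * g j y) = (\<Sum>i<k. 1 - b i x * b i y - a i x * a i y) - 2 * real l" for x y
  proof -
    have "(\<Sum>j\<in>J. f j x * g j y) = real k - 2 * real l - (\<Sum>q\<in>{..<k} \<times> UNIV. t q x * t q y)"
      by (auto simp: J_def f_def g_def sum.reindex sum_negf)
    also have "(\<Sum>q\<in>{..<k} \<times> UNIV. t q x * t q y) = (\<Sum>i<k. \<Sum>s\<in>UNIV. t (i, s) x * t (i, s) y)"
      by (simp add: sum.cartesian_product)
    also have "\<dots> = (\<Sum>i<k. b i x * b i y + a i x * a i y)"
      by (simp add: UNIV_bool t_def add.commute)
    finally show ?thesis by (simp add: sum_subtractf sum.distrib)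
  qed
  have "card W \<le> card J"
  proof (rule card_le_if_diagonal_eq_sum_rank_one[where f = f and g = g and d = "\<lambda>x. real (between_count u v x) - 2 * real l"])
    show "finite J" "finite W" using J W finite_V by (auto intro: finite_subset)
    show "real (between_count u v x) - 2 * real l \<noteq> 0" if "x \<in> W" for x
      using diag[OF that] by linarith
    fix x y assume xy: "x \<in> W" "y \<in> W"
    show "(\<Sum>j\<in>J. f j x * g j y) = (if x = y then real (between_count u v x) - 2 * real l else 0)"
    proof (cases "x = y")
      case True
      \<comment> \<open>The indicators are idempotent and never both 1, so the diagonal sums to
        \<open>between_count u v x\<close>.\<close>
      have "1 - b i x * b i x - a i x * a i x = of_bool (between (r i) u v x)" for i
        by (auto simp: a_def b_def between_def below_both_def above_both_def)
      then show ?thesis using True by (simp add: expand between_count_def)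
    next
      case False
      have "(\<Sum>i<k. 1 - b i x * b i y - a i x * a i y) =
          (\<Sum>i<k. of_bool (separates (r i) {u, x} {v, y}) + of_bool (separates (r i) {u, y} {v, x}))"
        unfolding a_def b_def using xy W uv False
        by (intro sum.cong refl separates_crossing_pairs[OF finite_V linear_order, symmetric]) auto
      also have "\<dots> = real (sep_count {u, x} {v, y} + sep_count {u, y} {v, x})"
        by (simp add: sep_count_def sum.distrib)
      \<comment> \<open>Off the diagonal both crossing counts equal \<open>l\<close>, by
        \<open>free\<close> for \<open>(x, y)\<close> and for \<open>(y, x)\<close>, and cancel
        \<open>2 * l\<close>.\<close>
      finally show ?thesis using False free[of x y] free[of y x] xy by (simp add: expand)
    qed
  qed
  then show ?thesis using J by simp
qed

text \<open>The counts of the three matchings of a 4-set sum to \<open>k\<close>, so they cannot all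
  be \<open>l\<close>. Every quadruple is thus one of three rearrangements of a member of
  \<open>B\<close>, and four members of \<open>B\<close> at most give the same conflict:
  \<open>12 = 3 * 4\<close>.\<close>

lemma card_conflicts_ge:
  assumes "3 * l \<noteq> k"
  defines "n \<equiv> card V"
  shows "n * (n - 1) * (n - 2) * (n - 3) \<le> 12 * card (conflicts l)"
proof -
  define Q where "Q = (SIGMA a:V. SIGMA b:V - {a}. SIGMA c:V - {a, b}. V - {a, b, c})"
  define B where "B = {(a, b, c, d). (a, b, c, d) \<in> Q \<and> sep_count {a, b} {c, d} \<noteq> l}"
  \<comment> \<open>These undo the rearrangements that move the second, respectively third, matching
    into first place.\<close>
  define h1 h2 :: "'a \<times> 'a \<times> 'a \<times> 'a \<Rightarrow> 'a \<times> 'a \<times> 'a \<times> 'a"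
    where "h1 = (\<lambda>(a, b, c, d). (a, c, b, d))" and "h2 = (\<lambda>(a, b, c, d). (a, c, d, b))"
  have finQ: "finite Q" using finite_V by (auto simp: Q_def)
  then have finB: "finite B" by (rule rev_finite_subset) (auto simp: B_def)
  have "card Q = n * (n - 1) * (n - 2) * (n - 3)"
    unfolding Q_def n_def by (rule card_distinct_quadruples[OF finite_V])
  moreover have "Q \<subseteq> B \<union> h1 ` B \<union> h2 ` B"
  proof
    fix q assume "q \<in> Q"
    then obtain a b c d where q: "q = (a, b, c, d)" "a \<in> V" "b \<in> V" "c \<in> V" "d \<in> V" "distinct [a, b, c, d]"
      by (auto simp: Q_def)
    from sep_count_three_matchings[OF q(2-)] assms(1)
    have "sep_count {a, b} {c, d} \<noteq> l \<or> sep_count {a, c} {b, d} \<noteq> l \<or> sep_count {a, d} {b, c} \<noteq> l"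
      by linarith
    then have "(a, b, c, d) \<in> B \<or> (a, c, b, d) \<in> B \<or> (a, d, b, c) \<in> B"
      using q by (auto simp: B_def Q_def)
    moreover have "h1 (a, c, b, d) = q" "h2 (a, d, b, c) = q" by (simp_all add: q h1_def h2_def)
    ultimately show "q \<in> B \<union> h1 ` B \<union> h2 ` B" by (metis Un_iff imageI q(1))
  qed
  then have "card Q \<le> card (B \<union> h1 ` B \<union> h2 ` B)" using finB by (intro card_mono) auto
  moreover have "card (B \<union> h1 ` B \<union> h2 ` B) \<le> card B + card B + card B"
    using card_Un_le[of "B \<union> h1 ` B" "h2 ` B"] card_Un_le[of B "h1 ` B"]
      card_image_le[OF finB, of h1] card_image_le[OF finB, of h2] by linarith
  moreover have "card B \<le> 4 * card (conflicts l)"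
  proof -
    let ?h = "\<lambda>(a, b, c, d). ((a, b), (c, d))" and ?e = "\<lambda>((a, b), (c, d)). ({a, b}, {c, d})"
    have "card B = card (?h ` B)" by (rule card_image[symmetric]) (auto intro: inj_onI)
    also have "\<dots> \<le> 4 * card (?e ` ?h ` B)" using finB by (intro card_le_card_doubleton_pairs) auto
    also have "card (?e ` ?h ` B) \<le> card (conflicts l)"
      by (intro card_mono finite_subset[OF conflicts_subset])
         (use finite_vertex_pairs[OF finite_V] in
           \<open>auto simp: B_def Q_def conflicts_def doubleton_in_vertex_pairs_iff\<close>)
    finally show ?thesis by simp
  qed
  ultimately show ?thesis by linarith
qed

text \<open>The counts of the three rotations of a triple sum to \<open>3 * l\<close>, so at most
  one of them is \<open>2 * l\<close>. Hence \<open>Z\<close> and its two rotations are disjoint,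
  and \<open>Z\<close> is at most a third of all triples.\<close>

lemma card_not_twice_between_ge:
  assumes "3 * l = k" "l > 0"
  defines "n \<equiv> card V"
  shows "2 * (n * (n - 1) * (n - 2)) \<le>
    3 * (\<Sum>u\<in>V. \<Sum>v\<in>V - {u}. card {x \<in> V - {u, v}. between_count u v x \<noteq> 2 * l})"
proof -
  define Q where "Q = (SIGMA u:V. SIGMA v:V - {u}. V - {u, v})"
  define Z where "Z = {(u, v, x). (u, v, x) \<in> Q \<and> between_count u v x = 2 * l}"
  define Y where "Y = (SIGMA u:V. SIGMA v:V - {u}. {x \<in> V - {u, v}. between_count u v x \<noteq> 2 * l})"
  define rot :: "'a \<times> 'a \<times> 'a \<Rightarrow> 'a \<times> 'a \<times> 'a" where "rot = (\<lambda>(u, v, x). (v, x, u))"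
  have finQ: "finite Q" using finite_V by (auto simp: Q_def)
  have cQ: "card Q = n * (n - 1) * (n - 2)"
    unfolding Q_def n_def by (rule card_distinct_triples[OF finite_V])
  have cY: "card Y = (\<Sum>u\<in>V. \<Sum>v\<in>V - {u}. card {x \<in> V - {u, v}. between_count u v x \<noteq> 2 * l})"
    using finite_V by (simp add: Y_def)
  have ZQ: "Z \<subseteq> Q" and "Y = Q - Z" by (auto simp: Z_def Y_def Q_def)
  then have QYZ: "card Q = card Y + card Z"
    using finQ card_Diff_subset[of Z Q] card_mono[of Q Z] finite_subset[of Z Q] by auto
  have inj: "inj rot" by (auto simp: rot_def inj_def)
  have fZ: "finite Z" using ZQ finQ finite_subset by blast
  have rotQ: "rot q \<in> Q" if "q \<in> Q" for q using that by (auto simp: rot_def Q_def)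
  have one: "rot q \<notin> Z" "rot (rot q) \<notin> Z" if "q \<in> Z" for q
  proof -
    obtain u v x where q: "q = (u, v, x)" by (cases q)
    then have "u \<in> V" "v \<in> V" "x \<in> V" "distinct [u, v, x]" "between_count u v x = 2 * l"
      using that by (auto simp: Z_def Q_def)
    then show "rot q \<notin> Z" "rot (rot q) \<notin> Z"
      using between_count_rotations[of u v x] assms by (auto simp: q rot_def Z_def)
  qed
  have dj: "Z \<inter> rot ` Z = {}" "Z \<inter> rot ` rot ` Z = {}"
    using one by blast+
  then have "rot ` Z \<inter> rot ` rot ` Z = {}"
    using inj by (metis image_Int image_empty)
  then have "(Z \<union> rot ` Z) \<inter> rot ` rot ` Z = {}" using dj by blast
  with dj(1) have "card (Z \<union> rot ` Z \<union> rot ` rot ` Z) = card Z + card (rot ` Z) + card (rot ` rot ` Z)"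
    using fZ by (simp add: card_Un_disjoint)
  also have "\<dots> = 3 * card Z" using inj by (simp add: card_image inj_on_subset)
  finally have "3 * card Z = card (Z \<union> rot ` Z \<union> rot ` rot ` Z)" by simp
  also have "\<dots> \<le> card Q"
  proof (rule card_mono[OF finQ])
    show "Z \<union> rot ` Z \<union> rot ` rot ` Z \<subseteq> Q" using ZQ rotQ by blast
  qed
  finally show ?thesis using QYZ cQ cY by linarith
qed

text \<open>Take all \<open>({u, x}, {v, y})\<close> with \<open>(x, y)\<close> in the greedy
  matching of \<open>u\<close> and \<open>v\<close>. Given \<open>e\<close>, there are two ways to
  name \<open>u\<close> and \<open>x\<close> and at most \<open>n\<close> choices of
  \<open>v\<close>, after which \<open>y\<close> is determined; the reversed pairs double
  \<open>2 * n\<close> to \<open>4 * n\<close>. The factor 24 is 3 from the two-thirds count, 2 from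
  matching elements in pairs and 4 from ordering the doubletons.\<close>

lemma exists_sparse_conflicts:
  assumes "3 * l = k" "l > 0"
  defines "n \<equiv> card V"
  shows "\<exists>R \<subseteq> conflicts l. sym R \<and> (\<forall>e. card (R `` {e}) \<le> 4 * n) \<and>
    2 * (n * (n - 1) * (n - 2)) \<le> 24 * card R + 3 * (n * (n - 1) * (2 * k + 1))"
proof -
  define X where "X u v = {x \<in> V - {u, v}. between_count u v x \<noteq> 2 * l}" for u v
  define matching where "matching u v M \<longleftrightarrow> M \<subseteq> X u v \<times> X u v \<and>
      (\<forall>(x, y)\<in>M. x \<noteq> y \<and> sep_count {u, x} {v, y} \<noteq> l) \<and>
      inj_on fst M \<and> inj_on snd M \<and> card (X u v) \<le> 2 * card M + (2 * k + 1)" for u v M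
  define P where "P u v = (SOME M. matching u v M)" for u v
  have P: "P u v \<subseteq> X u v \<times> X u v \<and> (\<forall>(x, y)\<in>P u v. x \<noteq> y \<and> sep_count {u, x} {v, y} \<noteq> l) \<and>
      inj_on fst (P u v) \<and> inj_on snd (P u v) \<and> card (X u v) \<le> 2 * card (P u v) + (2 * k + 1)"
    if uv: "u \<in> V" "v \<in> V - {u}" for u v
  proof -
    have "\<exists>M. matching u v M"
      unfolding matching_def
    proof (rule exists_large_partial_matching)
      show "finite (X u v)" using finite_V by (auto simp: X_def)
      fix W assume W: "W \<subseteq> X u v" "2 * k + 1 < card W"
      show "\<exists>x\<in>W. \<exists>y\<in>W. x \<noteq> y \<and> sep_count {u, x} {v, y} \<noteq> l"
      proof (rule ccontr)
        assume "\<not> ?thesis"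
        then have "card W \<le> 2 * k + 1"
          using W(1) uv by (intro card_conflict_free_le[of u v W l]) (auto simp: X_def)
        then show False using W(2) by simp
      qed
    qed
    then have "matching u v (P u v)" unfolding P_def by (rule someI_ex)
    then show ?thesis unfolding matching_def .
  qed
  define T where "T = (SIGMA u:V. SIGMA v:V - {u}. P u v)"
  define h :: "'a \<times> 'a \<times> 'a \<times> 'a \<Rightarrow> ('a \<times> 'a) \<times> ('a \<times> 'a)"
    where "h = (\<lambda>(u, v, x, y). ((u, x), (v, y)))"
  define E :: "('a \<times> 'a) \<times> ('a \<times> 'a) \<Rightarrow> 'a set \<times> 'a set" where "E = (\<lambda>((a, b), (c, d)). ({a, b}, {c, d}))"
  define R0 where "R0 = E ` h ` T"
  define R where "R = R0 \<union> R0\<inverse>"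
  have finP: "finite (P u v)" if "u \<in> V" "v \<in> V - {u}" for u v
    using P[OF that] finite_V by (auto simp: X_def intro: finite_subset)
  have finT: "finite T" using finite_V finP by (auto simp: T_def)
  have R0: "R0 = {({u, x}, {v, y}) |u v x y. u \<in> V \<and> v \<in> V - {u} \<and> (x, y) \<in> P u v}"
    by (force simp: R0_def T_def h_def E_def)
  have "R0 \<subseteq> conflicts l"
  proof
    fix q assume "q \<in> R0"
    then obtain u v x y where q: "q = ({u, x}, {v, y})" "u \<in> V" "v \<in> V - {u}" "(x, y) \<in> P u v"
      by (auto simp: R0)
    then show "q \<in> conflicts l"
      using P[OF q(2,3)] by (auto simp: conflicts_def doubleton_in_vertex_pairs_iff X_def)
  qed
  then have sub: "R \<subseteq> conflicts l"
    using sym_conflicts[of l] by (auto simp: R_def sym_def)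
  have "card (R `` {e}) \<le> 4 * n" for e
  proof -
    let ?F = "{(a, b). {a, b} = e}"
    let ?A = "\<lambda>u x v. (\<lambda>(x, y). {v, y}) ` {q \<in> P u v. fst q = x}"
    let ?B = "\<lambda>v y u. (\<lambda>(x, y). {u, x}) ` {q \<in> P u v. snd q = y}"
    \<comment> \<open>Used for both directions: \<open>(a, b)\<close> is one of at most two
      orderings of \<open>e\<close>, and \<open>c\<close> is the vertex playing the role opposite to
      \<open>a\<close>.\<close>
    have union_bound: "card (\<Union>(a, b)\<in>?F. \<Union>c\<in>V - {a}. G a b c) \<le> 2 * n"
      if G: "\<And>a b c. a \<in> V \<Longrightarrow> c \<in> V - {a} \<Longrightarrow> card (G a b c) \<le> 1" "\<And>a b c. a \<notin> V \<Longrightarrow> G a b c = {}"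
      for G :: "'a \<Rightarrow> 'a \<Rightarrow> 'a \<Rightarrow> 'a set set"
    proof -
      have inner: "card (\<Union>c\<in>V - {a}. G a b c) \<le> n" for a b
      proof (cases "a \<in> V")
        case True
        have "card (\<Union>c\<in>V - {a}. G a b c) \<le> (\<Sum>c\<in>V - {a}. card (G a b c))"
          using finite_V by (intro card_UN_le) auto
        also have "\<dots> \<le> (\<Sum>c\<in>V - {a}. 1)" using True by (intro sum_mono G)
        also have "\<dots> \<le> n" using finite_V by (simp add: n_def card_mono)
        finally show ?thesis .
      qed (simp add: G)
      have "card (\<Union>q\<in>?F. \<Union>c\<in>V - {fst q}. G (fst q) (snd q) c) \<le>
          (\<Sum>q\<in>?F. card (\<Union>c\<in>V - {fst q}. G (fst q) (snd q) c))"
        by (intro card_UN_le card_ordered_pairs_of_doubleton(2))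
      also have "\<dots> \<le> (\<Sum>q\<in>?F. n)" by (intro sum_mono inner)
      also have "\<dots> \<le> 2 * n" using card_ordered_pairs_of_doubleton(1)[of e] by simp
      finally show ?thesis by (simp add: case_prod_unfold)
    qed
    have single: "card (g ` {q \<in> P u v. f q = x}) \<le> 1" if inj: "inj_on f (P u v)"
      for f :: "'a \<times> 'a \<Rightarrow> 'a" and g :: "'a \<times> 'a \<Rightarrow> 'a set" and u v x
    proof -
      obtain q where "{q \<in> P u v. f q = x} \<subseteq> {q}"
        using inj unfolding inj_on_def by blast
      then have "g ` {q \<in> P u v. f q = x} \<subseteq> {g q}" by blast
      then have "card (g ` {q \<in> P u v. f q = x}) \<le> card {g q}" by (intro card_mono) auto
      then show ?thesis by simp
    qed
    \<comment> \<open>Emptied outside \<open>V\<close>, because nothing is known about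
      \<open>P\<close> there.\<close>
    define GA where "GA a b c = (if a \<in> V then ?A a b c else {})" for a b c
    define GB where "GB a b c = (if a \<in> V \<and> c \<in> V then ?B a b c else {})" for a b c
    have finG: "finite (GA a b c)" "finite (GB a b c)" if "c \<in> V - {a}" for a b c
      using finP[of a c] finP[of c a] that by (auto simp: GA_def GB_def)
    have "R0 `` {e} \<subseteq> (\<Union>(a, b)\<in>?F. \<Union>c\<in>V - {a}. GA a b c)"
      by (force simp: R0 GA_def)
    moreover have "R0\<inverse> `` {e} \<subseteq> (\<Union>(a, b)\<in>?F. \<Union>c\<in>V - {a}. GB a b c)"
      by (force simp: R0 GB_def)
    moreover have "finite (\<Union>(a, b)\<in>?F. \<Union>c\<in>V - {a}. GA a b c)" "finite (\<Union>(a, b)\<in>?F. \<Union>c\<in>V - {a}. GB a b c)"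
      by (intro finite_UN_I card_ordered_pairs_of_doubleton(2), use finite_V finG in auto)+
    moreover have "card (\<Union>(a, b)\<in>?F. \<Union>c\<in>V - {a}. GA a b c) \<le> 2 * n"
      using P by (intro union_bound) (auto simp: GA_def intro!: single[unfolded One_nat_def])
    moreover have "card (\<Union>(a, b)\<in>?F. \<Union>c\<in>V - {a}. GB a b c) \<le> 2 * n"
      using P by (intro union_bound) (auto simp: GB_def intro!: single[unfolded One_nat_def])
    ultimately have "card (R0 `` {e}) \<le> 2 * n" "card (R0\<inverse> `` {e}) \<le> 2 * n"
      by (meson card_mono order_trans)+
    then show ?thesis
      using card_Un_le[of "R0 `` {e}" "R0\<inverse> `` {e}"] by (simp add: R_def Un_Image)
  qed
  moreover have "sym R" by (auto simp: R_def sym_def)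
  moreover have "2 * (n * (n - 1) * (n - 2)) \<le> 24 * card R + 3 * (n * (n - 1) * (2 * k + 1))"
  proof -
    have "2 * (n * (n - 1) * (n - 2)) \<le> 3 * (\<Sum>u\<in>V. \<Sum>v\<in>V - {u}. card (X u v))"
      using card_not_twice_between_ge[OF assms(1,2)] by (simp add: X_def n_def)
    also have "(\<Sum>u\<in>V. \<Sum>v\<in>V - {u}. card (X u v)) \<le> (\<Sum>u\<in>V. \<Sum>v\<in>V - {u}. 2 * card (P u v) + (2 * k + 1))"
      using P by (intro sum_mono) blast
    also have "\<dots> = 2 * card T + n * (n - 1) * (2 * k + 1)"
    proof -
      have "card T = (\<Sum>u\<in>V. card (SIGMA v:V - {u}. P u v))"
        unfolding T_def using finite_V finP by (intro card_SigmaI) (auto intro!: finite_SigmaI)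
      also have "\<dots> = (\<Sum>u\<in>V. \<Sum>v\<in>V - {u}. card (P u v))"
        using finite_V finP by (intro sum.cong refl card_SigmaI) auto
      finally have "card T = (\<Sum>u\<in>V. \<Sum>v\<in>V - {u}. card (P u v))" .
      moreover have "(\<Sum>u\<in>V. \<Sum>v\<in>V - {u}. 2 * k + 1) = n * (n - 1) * (2 * k + 1)"
        using finite_V by (simp add: n_def distrib_left mult.assoc)
      ultimately show ?thesis by (simp only: sum.distrib sum_distrib_left)
    qed
    also have "card T = card (h ` T)" by (rule card_image[symmetric]) (auto intro: inj_onI simp: h_def)
    also have "\<dots> \<le> 4 * card R0"
      unfolding R0_def E_def using finT by (intro card_le_card_doubleton_pairs) auto
    also have "card R0 \<le> card R" using finT by (intro card_mono) (auto simp: R_def R0_def)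
    finally show ?thesis by simp
  qed
  ultimately show ?thesis using sub by blast
qed

end

section \<open>Probability of avoiding all conflicts\<close>

lemma independent_weight_antimono:
  assumes "finite S" "0 \<le> p" "p \<le> 1" "R \<subseteq> R'"
  shows "independent_weight p R' S \<le> independent_weight p R S"
  unfolding independent_weight_def using assms by (intro sum_mono2) auto

context order_family
begin

text \<open>Dropping conflicts only raises the weight, so a subset \<open>R\<close> with many pairs
  relative to its maximum degree may be used instead.\<close>

lemma independent_weight_conflicts_le_if_subset:
  assumes p: "0 < p" "p \<le> 1" and R: "R \<subseteq> conflicts l" "sym R"
    and D: "D > 0" "\<And>e. card (R `` {e}) \<le> D"
  shows "independent_weight p (conflicts l) (vertex_pairs V)
    \<le> exp (real (card (vertex_pairs V)) / real D - p * real (card R) / (4 * real D))"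
proof -
  let ?S = "vertex_pairs V"
  have fin: "finite ?S" using finite_V by (rule finite_vertex_pairs)
  have sub: "R \<subseteq> ?S \<times> ?S" using R(1) conflicts_subset by blast
  then have RS: "R \<inter> ?S \<times> ?S = R" "R `` {e} \<inter> ?S = R `` {e}" for e by auto
  have "irrefl R" using R(1) irrefl_conflicts[of l] by (auto simp: irrefl_def)
  then have "independent_weight p R ?S
      \<le> exp (- (p / (4 * real D)) * (real (card R) - 4 / p * real (card ?S)))"
    using independent_weight_le[OF fin p R(2), of D] D RS by simp
  also have "- (p / (4 * real D)) * (real (card R) - 4 / p * real (card ?S)) =
      real (card ?S) / real D - p * real (card R) / (4 * real D)"
    using p D by (simp add: field_simps)
  finally show ?thesis
    using independent_weight_antimono[OF fin _ p(2) R(1)] p by simp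
qed

text \<open>If \<open>3 * l \<noteq> k\<close>, use all conflicts with degree bound
  \<open>n ^ 2\<close>. Otherwise use the sparse conflicts with bound \<open>4 * n\<close>; this
  case determines both constants, as \<open>card (vertex_pairs V) / (4 * n)\<close> is at most
  \<open>n / 8\<close> and \<open>0.075 / 16\<close> exceeds \<open>0.0046\<close>.\<close>

lemma independent_weight_conflicts_le:
  fixes p :: real
  defines "n \<equiv> card V"
  assumes p: "0 < p" "p \<le> 1" and n: "100 \<le> n" "200 * k \<le> n" and l: "l > 0"
  shows "independent_weight p (conflicts l) (vertex_pairs V) \<le> exp (real n / 8 - 0.0046 * (real n ^ 2 * p))"
proof -
  let ?S = "vertex_pairs V"
  have fin: "finite ?S" using finite_V by (rule finite_vertex_pairs)
  have S: "2 * real (card ?S) \<le> real n ^ 2"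
    using card_vertex_pairs_le[OF finite_V] unfolding n_def
    by (metis of_nat_le_iff of_nat_mult of_nat_numeral of_nat_power)
  have n0: "real n > 0" using n by simp
  have shrink: "0.99 * real n \<le> real (n - 1)" "0.98 * real n \<le> real (n - 2)" "0.97 * real n \<le> real (n - 3)"
    using n by (auto simp: of_nat_diff)
  show ?thesis
  proof (cases "3 * l = k")
    case False
    let ?D = "n ^ 2"
    have "card (conflicts l `` {e}) \<le> ?D" for e
    proof -
      have "card (conflicts l `` {e}) \<le> card ?S"
        using fin conflicts_subset by (intro card_mono) auto
      also have "\<dots> \<le> ?D" using card_vertex_pairs_le[OF finite_V] by (simp add: n_def)
      finally show ?thesis .
    qed
    then have le: "independent_weight p (conflicts l) ?S
        \<le> exp (real (card ?S) / real ?D - p * real (card (conflicts l)) / (4 * real ?D))"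
      using n by (intro independent_weight_conflicts_le_if_subset p sym_conflicts) auto
    have "0.9 * real n ^ 4 \<le> real n * (0.99 * real n) * (0.98 * real n) * (0.97 * real n)"
      using n0 by (simp add: power4_eq_xxxx)
    also have "\<dots> \<le> real n * real (n - 1) * real (n - 2) * real (n - 3)"
      using n0 shrink by (intro mult_mono) auto
    also have "\<dots> = real (n * (n - 1) * (n - 2) * (n - 3))" by simp
    also have "\<dots> \<le> real (12 * card (conflicts l))"
      using card_conflicts_ge[OF False] unfolding n_def by (intro of_nat_mono)
    finally have R: "0.075 * real n ^ 4 \<le> real (card (conflicts l))" by simp
    have "0.0046 * (real n ^ 2 * p) \<le> p * (0.075 * real n ^ 4) / (4 * real n ^ 2)"
      using n0 p by (simp add: field_simps power4_eq_xxxx power2_eq_square)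
    also have "\<dots> \<le> p * real (card (conflicts l)) / (4 * real n ^ 2)"
      using n0 p R by (intro divide_right_mono mult_left_mono) auto
    finally have 1: "0.0046 * (real n ^ 2 * p) \<le> p * real (card (conflicts l)) / (4 * real ?D)" by simp
    have "real (card ?S) / real ?D \<le> 1 / 2" using S n0 by (simp add: field_simps)
    also have "\<dots> \<le> real n / 8" using n by simp
    finally show ?thesis using 1 by (intro order_trans[OF le]) simp
  next
    case True
    obtain R where R: "R \<subseteq> conflicts l" "sym R" "\<And>e. card (R `` {e}) \<le> 4 * n"
      and cR: "2 * (n * (n - 1) * (n - 2)) \<le> 24 * card R + 3 * (n * (n - 1) * (2 * k + 1))"
      using exists_sparse_conflicts[OF True l] unfolding n_def by blast
    have le: "independent_weight p (conflicts l) ?S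
        \<le> exp (real (card ?S) / real (4 * n) - p * real (card R) / (4 * real (4 * n)))"
      using n R by (intro independent_weight_conflicts_le_if_subset p) auto
    have "1.94 * real n ^ 3 \<le> 2 * (real n * (0.99 * real n) * (0.98 * real n))"
      using n0 by (simp add: power3_eq_cube)
    also have "\<dots> \<le> 2 * (real n * real (n - 1) * real (n - 2))"
      using n0 shrink by (intro mult_mono) auto
    also have "\<dots> = real (2 * (n * (n - 1) * (n - 2)))" by simp
    also have "\<dots> \<le> real (24 * card R + 3 * (n * (n - 1) * (2 * k + 1)))"
      using cR by (intro of_nat_mono)
    also have "\<dots> = 24 * real (card R) + 3 * (real n * real (n - 1) * (2 * real k + 1))"
      by (simp del: of_nat_diff add: distrib_left mult.assoc)
    also have "\<dots> \<le> 24 * real (card R) + 3 * (real n * real n * (0.02 * real n))"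
    proof -
      \<comment> \<open>Here \<open>2 * k\<close> is at most \<open>n / 100\<close>, and so is 1
        because \<open>n\<close> is at least 100.\<close>
      have "2 * real k + 1 \<le> 0.02 * real n" using n by simp
      then show ?thesis using n0 by (intro add_left_mono mult_left_mono mult_mono) auto
    qed
    \<comment> \<open>\<open>(1.94 - 3 * 0.02) / 24\<close> exceeds \<open>0.075\<close>.\<close>
    finally have cR': "0.075 * real n ^ 3 \<le> real (card R)" using n0 by (simp add: power3_eq_cube)
    have "0.0046 * (real n ^ 2 * p) \<le> p * (0.075 * real n ^ 3) / (16 * real n)"
      using n0 p by (simp add: field_simps power3_eq_cube power2_eq_square)
    also have "\<dots> \<le> p * real (card R) / (16 * real n)"
      using n0 p cR' by (intro divide_right_mono mult_left_mono) auto
    finally have 1: "0.0046 * (real n ^ 2 * p) \<le> p * real (card R) / (4 * real (4 * n))" by simp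
    have "real (card ?S) / real (4 * n) \<le> real n / 8"
      using S n0 by (simp add: field_simps power2_eq_square)
    then show ?thesis using 1 by (intro order_trans[OF le]) simp
  qed
qed

end

subsection \<open>The random graph\<close>

lemma pmf_gnp:
  assumes p: "0 \<le> p" "p \<le> 1" and A: "A \<subseteq> vertex_pairs {..<n}"
  shows "pmf (gnp_pmf n p) A = p ^ card A * (1 - p) ^ card (vertex_pairs {..<n} - A)"
proof -
  let ?S = "vertex_pairs {..<n}"
  let ?M = "Pi_pmf ?S False (\<lambda>_. bernoulli_pmf p)"
  have fin: "finite ?S" by (simp add: finite_vertex_pairs)
  have "pmf (gnp_pmf n p) A = measure_pmf.prob ?M ((\<lambda>X. {e \<in> ?S. X e}) -` {A} \<inter> set_pmf ?M)"
    by (simp add: gnp_pmf_def pmf_map measure_Int_set_pmf)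
  also have "(\<lambda>X. {e \<in> ?S. X e}) -` {A} \<inter> set_pmf ?M = {\<lambda>e. e \<in> A} \<inter> set_pmf ?M"
  proof -
    \<comment> \<open>On the support \<open>X\<close> is \<open>False\<close> outside
      \<open>?S\<close>, so the edge set determines \<open>X\<close>.\<close>
    have "{e \<in> ?S. X e} = A \<longleftrightarrow> X = (\<lambda>e. e \<in> A)" if "X \<in> set_pmf ?M" for X
    proof -
      have "\<not> X e" if "e \<notin> ?S" for e
        using that \<open>X \<in> set_pmf ?M\<close> set_Pi_pmf_subset[OF fin, of False "\<lambda>_. bernoulli_pmf p"] by blast
      then show ?thesis using A unfolding fun_eq_iff set_eq_iff by blast
    qed
    then show ?thesis by blast
  qed
  also have "measure_pmf.prob ?M \<dots> = pmf ?M (\<lambda>e. e \<in> A)"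
    by (simp add: measure_Int_set_pmf measure_pmf_single)
  also have "\<dots> = (\<Prod>e\<in>?S. pmf (bernoulli_pmf p) (e \<in> A))"
    using fin A by (intro pmf_Pi') auto
  also have "\<dots> = (\<Prod>e\<in>?S - A. pmf (bernoulli_pmf p) (e \<in> A)) * (\<Prod>e\<in>A. pmf (bernoulli_pmf p) (e \<in> A))"
    by (rule prod.subset_diff[OF A fin])
  also have "\<dots> = p ^ card A * (1 - p) ^ card (?S - A)"
    using p by simp
  finally show ?thesis .
qed

lemma set_pmf_gnp: "set_pmf (gnp_pmf n p) \<subseteq> Pow (vertex_pairs {..<n})"
  by (auto simp: gnp_pmf_def)

lemma prob_gnp_independent:
  assumes "0 \<le> p" "p \<le> 1"
  shows "measure_pmf.prob (gnp_pmf n p) {E. R \<inter> E \<times> E = {}} = independent_weight p R (vertex_pairs {..<n})"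
proof -
  let ?S = "vertex_pairs {..<n}" and ?M = "gnp_pmf n p"
  let ?I = "{E. E \<subseteq> ?S \<and> R \<inter> E \<times> E = {}}"
  have "?I \<inter> set_pmf ?M = {E. R \<inter> E \<times> E = {}} \<inter> set_pmf ?M"
    using set_pmf_gnp[of n p] by auto
  then have "measure_pmf.prob ?M {E. R \<inter> E \<times> E = {}} = measure_pmf.prob ?M ?I"
    using measure_Int_set_pmf[of ?M ?I] measure_Int_set_pmf[of ?M "{E. R \<inter> E \<times> E = {}}"] by simp
  also have "\<dots> = sum (pmf ?M) ?I"
    by (intro measure_measure_pmf_finite finite_subset[of ?I "Pow ?S"]) (auto simp: finite_vertex_pairs)
  also have "\<dots> = independent_weight p R ?S"
    unfolding independent_weight_def by (intro sum.cong refl pmf_gnp assms) auto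
  finally show ?thesis .
qed

subsection \<open>Existence of perfect separating families\<close>

text \<open>Glue bijections between \<open>e\<close> and \<open>e'\<close>, \<open>f\<close> and
  \<open>f'\<close>, and the complements.\<close>

lemma exists_bij_betw_two_sets:
  assumes V: "finite V" and sub: "e \<subseteq> V" "f \<subseteq> V" "e' \<subseteq> V" "f' \<subseteq> V"
    and card: "card e = card e'" "card f = card f'" and disj: "e \<inter> f = {}" "e' \<inter> f' = {}"
  obtains g where "bij_betw g V V" "g ` e = e'" "g ` f = f'"
proof -
  have fin: "finite e" "finite f" "finite e'" "finite f'" using sub V finite_subset by blast+
  have "card (V - (e \<union> f)) = card (V - (e' \<union> f'))"
    using sub fin card disj by (simp add: card_Diff_subset card_Un_disjoint)
  then obtain g1 g2 g3 where g: "bij_betw g1 e e'" "bij_betw g2 f f'" "bij_betw g3 (V - (e \<union> f)) (V - (e' \<union> f'))"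
    using finite_same_card_bij fin card V by (metis finite_Diff)
  define g where "g x = (if x \<in> e then g1 x else if x \<in> f then g2 x else g3 x)" for x
  have ge: "bij_betw g e e'"
    by (rule iffD1[OF bij_betw_cong g(1)]) (simp add: g_def)
  have gf: "bij_betw g f f'"
    by (rule iffD1[OF bij_betw_cong g(2)]) (use disj in \<open>auto simp: g_def\<close>)
  have gr: "bij_betw g (V - (e \<union> f)) (V - (e' \<union> f'))"
    by (rule iffD1[OF bij_betw_cong g(3)]) (simp add: g_def)
  have "bij_betw g (e \<union> f \<union> (V - (e \<union> f))) (e' \<union> f' \<union> (V - (e' \<union> f')))"
    using disj by (intro bij_betw_combine ge gf gr) auto
  moreover have "e \<union> f \<union> (V - (e \<union> f)) = V" "e' \<union> f' \<union> (V - (e' \<union> f')) = V" using sub by auto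
  ultimately have "bij_betw g V V" by simp
  then show thesis using that ge gf by (auto simp: bij_betw_def)
qed

text \<open>Relabelling along a permutation of \<open>V\<close> that maps \<open>e\<close> to
  \<open>e'\<close> and \<open>f\<close> to \<open>f'\<close> is an injection between the two sets
  of orders. Exchanging the roles gives equality.\<close>

lemma card_separating_orders_le:
  assumes V: "finite V" and ef: "e \<in> vertex_pairs V" "f \<in> vertex_pairs V" "e \<inter> f = {}"
    and ef': "e' \<in> vertex_pairs V" "f' \<in> vertex_pairs V" "e' \<inter> f' = {}"
  shows "card {r. linear_order_on V r \<and> separates r e f} \<le> card {r. linear_order_on V r \<and> separates r e' f'}"
proof -
  obtain g where g: "bij_betw g V V" "g ` e = e'" "g ` f = f'"
    using exists_bij_betw_two_sets[OF V, of e f e' f'] ef ef' by (auto simp: vertex_pairs_def)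
  have inj: "inj_on g V" and surj: "g ` V = V" using g by (auto simp: bij_betw_def)
  have subs: "e \<subseteq> V" "f \<subseteq> V" using ef by (auto simp: vertex_pairs_def)
  have field: "Field r = V" "r \<subseteq> V \<times> V" if "linear_order_on V r" for r
    using that by (auto simp: order_on_defs Field_def refl_on_def)
  have mem: "(g x, g y) \<in> dir_image r g \<longleftrightarrow> (x, y) \<in> r" if "linear_order_on V r" "x \<in> V" "y \<in> V" for r x y
    using field(2)[OF that(1)] that inj by (auto simp: dir_image_def dest: inj_onD)
  have prec: "all_precede (dir_image r g) (g ` A) (g ` B) = all_precede r A B"
    if "linear_order_on V r" "A \<subseteq> V" "B \<subseteq> V" for r A B
    using that mem[OF that(1)] inj unfolding all_precede_def inj_on_def by blast
  show ?thesis
  proof (rule card_inj_on_le[where f = "\<lambda>r. dir_image r g"])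
    show "finite {r. linear_order_on V r \<and> separates r e' f'}"
      by (rule finite_subset[OF _ card_linear_orders_le(1)[OF V]]) auto
    show "inj_on (\<lambda>r. dir_image r g) {r. linear_order_on V r \<and> separates r e f}"
    proof (rule inj_onI)
      fix r s assume *: "r \<in> {r. linear_order_on V r \<and> separates r e f}"
        "s \<in> {r. linear_order_on V r \<and> separates r e f}" "dir_image r g = dir_image s g"
      have "(x, y) \<in> r \<longleftrightarrow> (x, y) \<in> s" for x y
        using * mem[of r x y] mem[of s x y] field(2)[of r] field(2)[of s] by auto
      then show "r = s" by auto
    qed
    show "(\<lambda>r. dir_image r g) ` {r. linear_order_on V r \<and> separates r e f}
        \<subseteq> {r. linear_order_on V r \<and> separates r e' f'}"
    proof (clarify, intro conjI)
      fix r assume r: "linear_order_on V r" "separates r e f"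
      show "linear_order_on V (dir_image r g)"
        using Linear_order_dir_image[of r g] r(1) inj surj by (simp add: field dir_image_Field)
      show "separates (dir_image r g) e' f'"
        using r(2) prec[OF r(1)] subs unfolding separates_def g(2,3)[symmetric] by blast
    qed
  qed
qed

text \<open>Needed because \<open>PSD\<close> is a \<open>LEAST\<close>, which says nothing without
  a witness. In the family of all orders, symmetry gives every disjoint pair the same count.\<close>

lemma exists_perfect_separating_family:
  assumes V: "finite V" and E: "E \<subseteq> vertex_pairs V"
  shows "\<exists>F. perfect_separating_family V E F"
proof -
  let ?L = "{r. linear_order_on V r}"
  define s where "s e f = card {r. linear_order_on V r \<and> separates r e f}" for e f
  have finL: "finite ?L" by (rule card_linear_orders_le(1)[OF V])
  have size: "size (filter_mset (\<lambda>r. separates r e f) (mset_set ?L)) = s e f" for e f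
    using finL by (simp add: s_def)
  have eq: "s e f = s e' f'" if "e \<in> vertex_pairs V" "f \<in> vertex_pairs V" "e \<inter> f = {}"
    "e' \<in> vertex_pairs V" "f' \<in> vertex_pairs V" "e' \<inter> f' = {}" for e f e' f'
    unfolding s_def using that by (intro le_antisym card_separating_orders_le V)
  have pos: "s e f > 0" if ef: "e \<in> vertex_pairs V" "f \<in> vertex_pairs V" "e \<inter> f = {}" for e f
  proof -
    obtain a b c d where abcd: "e = {a, b}" "f = {c, d}" "a \<noteq> b" "c \<noteq> d"
      using ef by (auto simp: vertex_pairs_def card_2_iff)
    have mem: "a \<in> V" "b \<in> V" "c \<in> V" "d \<in> V" "distinct [a, b, c, d]"
      using ef abcd by (auto simp: vertex_pairs_def)
    obtain r where r: "linear_order_on V r"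
      using Zorn.well_order_on[of V] by (auto simp: well_order_on_def)
    \<comment> \<open>Any order separates some matching of the four vertices, and by
      \<open>eq\<close> the count of that matching is also that of \<open>e\<close> and
      \<open>f\<close>.\<close>
    have "separates r {a, b} {c, d} \<or> separates r {a, c} {b, d} \<or> separates r {a, d} {b, c}"
      using separates_three_matchings[OF V r mem] by (auto simp: of_bool_def split: if_splits)
    moreover have "s e f > 0" if "separates r e' f'" and ef': "e' \<in> vertex_pairs V" "f' \<in> vertex_pairs V" "e' \<inter> f' = {}"
      for e' f'
    proof -
      have "{r. linear_order_on V r \<and> separates r e' f'} \<noteq> {}" using r that(1) by blast
      moreover have "finite {r. linear_order_on V r \<and> separates r e' f'}"
        by (rule finite_subset[OF _ finL]) auto
      ultimately have "s e' f' > 0" by (simp add: s_def card_gt_0_iff)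
      then show ?thesis using eq[OF ef ef'] by simp
    qed
    ultimately show ?thesis
      using mem by (elim disjE) (simp_all add: doubleton_in_vertex_pairs_iff)
  qed
  have "\<exists>l>0. \<forall>e\<in>E. \<forall>f\<in>E. e \<inter> f = {} \<longrightarrow> s e f = l"
  proof (cases "\<exists>e\<in>E. \<exists>f\<in>E. e \<inter> f = {}")
    case True
    then obtain e f where ef: "e \<in> E" "f \<in> E" "e \<inter> f = {}" by blast
    then show ?thesis using E pos eq by (intro exI[of _ "s e f"]) (meson subsetD)
  qed auto
  moreover have "\<exists>r\<in>#mset_set ?L. separates r e f" if "e \<in> E" "f \<in> E" "e \<inter> f = {}" for e f
    using pos[of e f] that E finL by (auto simp: s_def card_gt_0_iff)
  ultimately have "perfect_separating_family V E (mset_set ?L)"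
    unfolding perfect_separating_family_def separating_family_def size using finL by auto
  then show ?thesis by blast
qed

lemma perfect_separating_family_PSD:
  assumes "finite V" "E \<subseteq> vertex_pairs V"
  obtains F where "perfect_separating_family V E F" "size F = PSD V E"
  using LeastI_ex[of "\<lambda>k. \<exists>F. perfect_separating_family V E F \<and> size F = k"]
    exists_perfect_separating_family[OF assms] unfolding PSD_def by blast

text \<open>The range of \<open>l\<close> includes \<open>1\<close> even if \<open>k = 0\<close>: for graphs without disjoint edges any
  positive \<open>l\<close> will do.\<close>

lemma perfect_separating_family_conflict_free:
  assumes V: "finite V" and E: "E \<subseteq> vertex_pairs V"
    and F: "perfect_separating_family V E F" "size F = k"
  shows "\<exists>xs. set xs \<subseteq> {r. linear_order_on V r} \<and> length xs = k \<and>
    (\<exists>l\<in>{1..k + 1}. order_family.conflicts V k (nth xs) l \<inter> E \<times> E = {})"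
proof -
  obtain xs where xs: "mset xs = F" using ex_mset by blast
  then have len: "length xs = k" using F(2) by auto
  have lin: "set xs \<subseteq> {r. linear_order_on V r}"
    using F(1) xs by (auto simp: perfect_separating_family_def separating_family_def)
  interpret order_family V k "nth xs"
    by unfold_locales (use V lin len in \<open>auto simp: subset_iff\<close>)
  have size: "size (filter_mset (\<lambda>r. separates r e f) F) = sep_count e f" for e f
  proof -
    have "size (filter_mset (\<lambda>r. separates r e f) F) = card {i. i < k \<and> separates (xs ! i) e f}"
      by (simp add: xs[symmetric] mset_filter[symmetric] length_filter_conv_card len del: mset_filter)
    also have "\<dots> = sep_count e f" by (simp add: sep_count_def Collect_conj_eq lessThan_def)
    finally show ?thesis .
  qed
  have sep_le: "sep_count e f \<le> k" for e f
    using size_filter_mset_lesseq[of "\<lambda>r. separates r e f" F] F(2) by (simp add: size)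
  obtain l where l: "l > 0" "\<And>e f. e \<in> E \<Longrightarrow> f \<in> E \<Longrightarrow> e \<inter> f = {} \<Longrightarrow> sep_count e f = l"
    using F(1) unfolding perfect_separating_family_def size by blast
  have "\<exists>l\<in>{1..k + 1}. conflicts l \<inter> E \<times> E = {}"
  proof (cases "\<exists>e\<in>E. \<exists>f\<in>E. e \<inter> f = {}")
    case True
    \<comment> \<open>\<open>l\<close> is the count of an actual pair, hence at most the number of
      orders.\<close>
    then have "l \<le> k" using l(2) sep_le by metis
    then show ?thesis using l by (intro bexI[of _ l]) (auto simp: conflicts_def)
  next
    case False
    then show ?thesis by (intro bexI[of _ 1]) (auto simp: conflicts_def)
  qed
  then show ?thesis using lin len by blast
qed

subsection \<open>The union bound\<close>

text \<open>The left side is \<open>exp (k * n * ln n)\<close>. As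
  \<open>ln n / log 2 n = ln 2\<close>, the exponent is at most
  \<open>ln 2 / 200 * n\<^sup>2 * p\<close>, and \<open>ln 2\<close> is at most
  \<open>0.7\<close>.\<close>

lemma order_count_le_exp:
  fixes p :: real
  assumes n: "2 \<le> n" and k: "real k < real n * p / (200 * log 2 (real n))" and p: "0 < p"
  shows "real ((n ^ n) ^ k) \<le> exp (0.0035 * (real n ^ 2 * p))"
proof -
  have ln: "ln (real n) > 0" using n by simp
  have ln2: "ln (2::real) \<le> 0.7" using ln2_le_25_over_36 by simp
  have "real k * (real n * ln (real n)) \<le> real n * p / (200 * log 2 (real n)) * (real n * ln (real n))"
    using k ln n by (intro mult_right_mono) auto
  also have "\<dots> = ln 2 / 200 * (real n ^ 2 * p)"
    using ln by (simp add: log_def field_simps power2_eq_square)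
  also have "\<dots> \<le> 0.0035 * (real n ^ 2 * p)"
    using ln2 p n by (intro mult_right_mono) auto
  finally have *: "real k * (real n * ln (real n)) \<le> 0.0035 * (real n ^ 2 * p)" .
  have "real ((n ^ n) ^ k) = exp (ln (real n)) ^ (n * k)" using n by (simp add: power_mult)
  also have "\<dots> = exp (real k * (real n * ln (real n)))"
    by (simp add: exp_of_nat_mult[symmetric] mult_ac)
  also have "\<dots> \<le> exp (0.0035 * (real n ^ 2 * p))" using * by simp
  finally show ?thesis .
qed

text \<open>Union bound over the size \<open>k\<close>, the list of orders and \<open>l\<close>.
  There are at most \<open>n * (n + 1)\<close> choices of \<open>k\<close> and \<open>l\<close>, and
  the gain \<open>0.0046\<close> beats the cost \<open>0.0035\<close> of the lists by
  \<open>0.0011\<close>.\<close>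

lemma prob_PSD_small_le:
  fixes p :: real
  assumes n: "100 \<le> n" and p: "real n powr (-0.4) \<le> p" "p < 1"
  shows "measure_pmf.prob (gnp_pmf n p) {E. real (PSD {..<n} E) < real n * p / (200 * log 2 (real n))}
    \<le> real n * (real n + 1) * exp (real n / 8 - 0.0011 * real n powr 1.6)"
proof -
  let ?V = "{..<n}" and ?M = "gnp_pmf n p"
  define L where "L = {r. linear_order_on ?V r}"
  define b where "b = real n * p / (200 * log 2 (real n))"
  define K where "K = {k. real k < b}"
  define X where "X k = {xs. set xs \<subseteq> L \<and> length xs = k}" for k
  define Idx where "Idx = (SIGMA k:K. X k \<times> {1..k + 1})"
  define Ev where "Ev = (\<lambda>(k, xs, l). {E. order_family.conflicts ?V k (nth xs) l \<inter> E \<times> E = {}})"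
  define c where "c = exp (real n / 8 - 0.0046 * (real n ^ 2 * p))"
  have "0 < real n powr (-0.4)" using n by simp
  then have p0: "p > 0" using p(1) by linarith
  have L: "finite L" "card L \<le> n ^ n"
    using card_linear_orders_le[of ?V] by (simp_all add: L_def)
  have finX: "finite (X k)" for k unfolding X_def by (rule finite_lists_length_eq[OF L(1)])
  have cardX: "real (card (X k)) \<le> exp (0.0035 * (real n ^ 2 * p))" if "k \<in> K" for k
  proof -
    have "card (X k) = card L ^ k" unfolding X_def by (rule card_lists_length_eq[OF L(1)])
    also have "\<dots> \<le> (n ^ n) ^ k" using L(2) by (rule power_mono) simp
    finally have "real (card (X k)) \<le> real ((n ^ n) ^ k)" by (simp only: of_nat_le_iff)
    also have "\<dots> \<le> exp (0.0035 * (real n ^ 2 * p))"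
      using that n p0 by (intro order_count_le_exp) (auto simp: K_def b_def)
    finally show ?thesis .
  qed
  \<comment> \<open>This supplies the hypothesis \<open>200 * k \<le> n\<close> of the bound for a
    fixed list.\<close>
  have "b \<le> real n / 200"
  proof -
    have "1 \<le> log 2 (real n)" using n by (simp add: le_log_iff)
    moreover have "real n * p \<le> real n" using p by (simp add: mult_left_le)
    ultimately have "b \<le> real n / (200 * 1)"
      unfolding b_def using n by (intro frac_le) auto
    then show ?thesis by simp
  qed
  then have K: "200 * k \<le> n" if "k \<in> K" for k using that unfolding K_def by simp
  have KV: "K \<subseteq> {..<n}" using K n by fastforce
  then have finK: "finite K" "card K \<le> n" using finite_subset card_mono[of "{..<n}" K] by auto
  have finI: "finite Idx" using finK finX by (auto simp: Idx_def)
  have Ev: "measure_pmf.prob ?M (Ev q) \<le> c" if "q \<in> Idx" for q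
  proof -
    obtain k xs l where q: "q = (k, xs, l)" by (cases q)
    then have q': "k \<in> K" "set xs \<subseteq> L" "length xs = k" "l \<in> {1..k + 1}" using that by (auto simp: Idx_def X_def)
    interpret order_family ?V k "nth xs"
      by unfold_locales (use q' in \<open>auto simp: L_def subset_iff\<close>)
    show ?thesis
      using independent_weight_conflicts_le[of p l] K[OF q'(1)] q' p p0 n
      by (simp add: q Ev_def prob_gnp_independent c_def)
  qed
  \<comment> \<open>Restricting to the support ensures that \<open>E\<close> consists of vertex
    pairs, so that \<open>PSD\<close> is attained by a family.\<close>
  have sub: "{E. real (PSD ?V E) < b} \<inter> set_pmf ?M \<subseteq> (\<Union>q\<in>Idx. Ev q)"
  proof
    fix E assume "E \<in> {E. real (PSD ?V E) < b} \<inter> set_pmf ?M"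
    then have E: "PSD ?V E \<in> K" "E \<subseteq> vertex_pairs ?V" using set_pmf_gnp[of n p] by (auto simp: K_def)
    obtain F where "perfect_separating_family ?V E F" "size F = PSD ?V E"
      using perfect_separating_family_PSD[OF _ E(2)] by auto
    from perfect_separating_family_conflict_free[OF _ E(2) this]
    obtain xs l where "set xs \<subseteq> L" "length xs = PSD ?V E" "l \<in> {1..PSD ?V E + 1}"
      "order_family.conflicts ?V (PSD ?V E) (nth xs) l \<inter> E \<times> E = {}"
      unfolding L_def by auto
    then have "(PSD ?V E, xs, l) \<in> Idx" "E \<in> Ev (PSD ?V E, xs, l)"
      using E(1) by (auto simp: Idx_def X_def Ev_def)
    then show "E \<in> (\<Union>q\<in>Idx. Ev q)" by blast
  qed
  have "measure_pmf.prob ?M {E. real (PSD ?V E) < b} = measure_pmf.prob ?M ({E. real (PSD ?V E) < b} \<inter> set_pmf ?M)"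
    by (simp add: measure_Int_set_pmf)
  also have "\<dots> \<le> measure_pmf.prob ?M (\<Union>q\<in>Idx. Ev q)"
    by (intro measure_pmf.finite_measure_mono sub) simp
  also have "\<dots> \<le> (\<Sum>q\<in>Idx. measure_pmf.prob ?M (Ev q))"
    by (intro measure_pmf.finite_measure_subadditive_finite finI) simp
  also have "\<dots> \<le> real (card Idx) * c"
    using sum_bounded_above[of Idx "\<lambda>q. measure_pmf.prob ?M (Ev q)" c] Ev by simp
  also have "real (card Idx) \<le> real n * (real n + 1) * exp (0.0035 * (real n ^ 2 * p))"
  proof -
    have "card Idx = (\<Sum>k\<in>K. card (X k) * (k + 1))"
      using finK finX by (simp add: Idx_def card_cartesian_product)
    then have "real (card Idx) = (\<Sum>k\<in>K. real (card (X k)) * (real k + 1))"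
      by (simp add: distrib_left add.commute)
    also have "\<dots> \<le> (\<Sum>k\<in>K. exp (0.0035 * (real n ^ 2 * p)) * (real n + 1))"
      using cardX KV by (intro sum_mono mult_mono) auto
    also have "\<dots> = real (card K) * (exp (0.0035 * (real n ^ 2 * p)) * (real n + 1))" by simp
    also have "\<dots> \<le> real n * (exp (0.0035 * (real n ^ 2 * p)) * (real n + 1))"
      using finK by (intro mult_right_mono) auto
    finally show ?thesis by (simp add: mult_ac)
  qed
  then have "real (card Idx) * c \<le> real n * (real n + 1) * exp (0.0035 * (real n ^ 2 * p)) * c"
    by (rule mult_right_mono) (simp add: c_def)
  also have "\<dots> = real n * (real n + 1) * exp (real n / 8 - 0.0011 * (real n ^ 2 * p))"
    by (simp add: c_def exp_add[symmetric] algebra_simps)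
  also have "\<dots> \<le> real n * (real n + 1) * exp (real n / 8 - 0.0011 * real n powr 1.6)"
  proof -
    \<comment> \<open>The lower bound on \<open>p\<close> enters here:
      \<open>2 - 0.4 = 1.6\<close>.\<close>
    have "real n powr 1.6 = real n powr (2 + -0.4)" by simp
    also have "\<dots> = real n powr 2 * real n powr (-0.4)" by (rule powr_add)
    also have "\<dots> = real n ^ 2 * real n powr (-0.4)" using n by (simp add: powr_realpow)
    also have "\<dots> \<le> real n ^ 2 * p" using p by (intro mult_left_mono) auto
    finally show ?thesis by (intro mult_left_mono) auto
  qed
  finally show ?thesis unfolding b_def .
qed

theorem theorem2:
  fixes p :: "nat \<Rightarrow> real"
  assumes "\<And>n. n \<ge> 2 \<Longrightarrow> real n powr (-0.4) \<le> p n \<and> p n < 1"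
  shows "(\<lambda>n. measure_pmf.prob (gnp_pmf n (p n))
            {E. real (PSD {..<n} E) \<ge> real n * p n / (200 * log 2 (real n))})
         \<longlonglongrightarrow> 1"
proof (rule tendsto_sandwich)
  \<comment> \<open>Since 1.6 exceeds 1, the negative term of the exponent dominates both
    \<open>n / 8\<close> and the polynomial factor.\<close>
  show "(\<lambda>n. 1 - real n * (real n + 1) * exp (real n / 8 - 0.0011 * real n powr 1.6)) \<longlonglongrightarrow> 1"
    by real_asymp
  show "\<forall>\<^sub>F n in sequentially. 1 - real n * (real n + 1) * exp (real n / 8 - 0.0011 * real n powr 1.6)
      \<le> measure_pmf.prob (gnp_pmf n (p n))
            {E. real (PSD {..<n} E) \<ge> real n * p n / (200 * log 2 (real n))}"
    using eventually_ge_at_top[of 100]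
  proof eventually_elim
    case (elim n)
    let ?A = "{E. real (PSD {..<n} E) < real n * p n / (200 * log 2 (real n))}"
    have "measure_pmf.prob (gnp_pmf n (p n)) ?A
        \<le> real n * (real n + 1) * exp (real n / 8 - 0.0011 * real n powr 1.6)"
      using assms[of n] elim by (intro prob_PSD_small_le) auto
    moreover have "{E. real (PSD {..<n} E) \<ge> real n * p n / (200 * log 2 (real n))} = UNIV - ?A" by auto
    ultimately show ?case
      using measure_pmf.prob_compl[of ?A "gnp_pmf n (p n)"] by simp
  qed
qed auto

end
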